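(* Let $\gamma$ be an orientation preserving isometry of $\mathbb{H}^4$. Then for every half-turn factorization $\gamma=H_PH_Q$, the circles $\partial P$ and $\partial Q$ are elements of $\mathcal{K}_\gamma$.
   Context: Work in $\mathbb{H}^4$ with boundary $\widehat{\mathbb{R}^3}$. For a plane $P$, $H_P$ is the half-turn about $P$: the orientation preserving involution obtained as the composition of reflections across two orthogonal hyperplanes intersecting in $P$. The half-turn bank $\mathcal{K}_\gamma$ is the following set of circles: (i) If $\gamma$ is atomic (type-I elliptic, pure hyperbolic or pure parabolic), $\mathcal{K}_\gamma=\{s\cap t: s\in\mathcal{F}_\gamma,\ t\in\mathcal{T}_\gamma\}$, where: for type-I elliptic $\gamma$ with fixed plane $P$, $\mathcal{F}_\gamma$ = boundaries of hyperplanes containing $P$, $\mathcal{T}_\gamma$ = boundaries of hyperplanes orthogonal to $P$; for pure hyperbolic $\gamma$ with axis $L$, $\mathcal{F}_\gamma$ = boundaries of hyperplanes orthogonal to $L$, $\mathcal{T}_\gamma$ = boundaries of hyperplanes containing $L$; for pure parabolic $\gamma$ conjugated to $x\mapsto x+b$, $\mathcal{F}_\gamma$ = Euclidean planes orthogonal to $b$ (with $\infty$), $\mathcal{T}_\gamma$ = Euclidean planes parallel to $b$ (with $\infty$). (ii) If $\gamma$ is pure loxodromic or screw parabolic, $\gamma=\tau\rho=\rho\tau$ with translation part $\tau$ and rotational part $\rho$ (type-I elliptic with fixed plane $P$, the twisting plane); $\mathcal{K}_\gamma=\{s\cap t: s\in\mathcal{F}_\tau,\ t\in\mathcal{R}_\gamma\}$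 with $\mathcal{R}_\gamma$ the boundaries of hyperplanes containing $P$. (iii) If $\gamma$ is type-II elliptic (unique fixed point) and not an involution, $\gamma=\rho_1\rho_2$ with $\rho_i$ the unique commuting type-I elliptic isometries whose fixed planes meet orthogonally at the fixed point, and $\mathcal{K}_\gamma=\{s\cap t: s\in\mathcal{F}_{\rho_1},\ t\in\mathcal{F}_{\rho_2}\}$. (iv) If $\gamma$ is a type-II elliptic involution with fixed point $x$, $\mathcal{K}_\gamma$ = boundaries of all planes through $x$. (v) $\mathcal{K}_{\mathrm{id}}$ = boundaries of all planes.
   Formalization: For non-involutive type-II elliptic γ the commuting pair ρ1, ρ2 is not unique when both rotation angles agree up to sign, so K_γ is there undefined; K_γ is taken as the union over all admissible pairs, which changes nothing where the pair is unique. *)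

theory Defs
  imports "HOL-Analysis.Analysis"
begin

definition eta :: "5 \<Rightarrow> real" where
  "eta i = (if i = 0 then -1 else 1)"

definition mink :: "real^5 \<Rightarrow> real^5 \<Rightarrow> real" where
  "mink x y = (\<Sum>i\<in>UNIV. eta i * x$i * y$i)"

definition hyp :: "(real^5) set" where
  "hyp = {x. mink x x = -1 \<and> x$0 > 0}"

text \<open>Ideal boundary: null directions, normalised by x0 = 1 (a 3-sphere, the
  boundary of the Klein ball); it is conformally the one-point compactification of R^3.\<close>
definition ideal :: "(real^5) set" where
  "ideal = {x. mink x x = 0 \<and> x$0 = 1}"

text \<open>Boundary at infinity of a set of points of H^4 (closure in the Klein model).\<close>
definition ideal_bd :: "(real^5) set \<Rightarrow> (real^5) set" where
  "ideal_bd S = closure ((\<lambda>x. (1 / x$0) *\<^sub>R x) ` S) \<inter> ideal"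

definition isom :: "real^5^5 \<Rightarrow> bool" where
  "isom A \<longleftrightarrow> (\<forall>x y. mink (A *v x) (A *v y) = mink x y) \<and> (\<forall>x\<in>hyp. A *v x \<in> hyp)"

definition orient_pres :: "real^5^5 \<Rightarrow> bool" where
  "orient_pres A \<longleftrightarrow> isom A \<and> det A = 1"

definition gsub :: "nat \<Rightarrow> (real^5) set \<Rightarrow> bool" where
  "gsub k S \<longleftrightarrow> (\<exists>W. subspace W \<and> dim W = k + 1 \<and> S = W \<inter> hyp \<and> S \<noteq> {})"

abbreviation "is_line \<equiv> gsub 1"
abbreviation "is_plane \<equiv> gsub 2"
abbreviation "is_hyperplane \<equiv> gsub 3"

definition hyperplane_of :: "real^5 \<Rightarrow> (real^5) set" where
  "hyperplane_of n = {x\<in>hyp. mink x n = 0}"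

definition orth_to :: "(real^5) set \<Rightarrow> (real^5) set \<Rightarrow> bool" where
  "orth_to H S \<longleftrightarrow> (\<exists>n. mink n n > 0 \<and> H = hyperplane_of n \<and> n \<in> span S)"

definition refl :: "real^5 \<Rightarrow> real^5^5" where
  "refl n = (\<chi> i j. (if i = j then 1 else 0) - 2 * n$i * (eta j * n$j) / mink n n)"

definition half_turn :: "(real^5) set \<Rightarrow> real^5^5 \<Rightarrow> bool" where
  "half_turn P HP \<longleftrightarrow> (\<exists>u v. mink u u > 0 \<and> mink v v > 0 \<and> mink u v = 0 \<and>
      hyperplane_of u \<inter> hyperplane_of v = P \<and> HP = refl u ** refl v)"

definition fixpts :: "real^5^5 \<Rightarrow> (real^5) set" where
  "fixpts A = {x\<in>hyp. A *v x = x}"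

definition ideal_fix :: "real^5^5 \<Rightarrow> (real^5) set" where
  "ideal_fix A = {\<xi>\<in>ideal. \<exists>c>0. A *v \<xi> = c *\<^sub>R \<xi>}"

definition elliptic :: "real^5^5 \<Rightarrow> bool" where
  "elliptic A \<longleftrightarrow> orient_pres A \<and> fixpts A \<noteq> {}"

definition type1 :: "real^5^5 \<Rightarrow> bool" where
  "type1 A \<longleftrightarrow> orient_pres A \<and> is_plane (fixpts A)"

definition type2 :: "real^5^5 \<Rightarrow> bool" where
  "type2 A \<longleftrightarrow> orient_pres A \<and> (\<exists>x. fixpts A = {x})"

definition parabolic :: "real^5^5 \<Rightarrow> bool" where
  "parabolic A \<longleftrightarrow> orient_pres A \<and> fixpts A = {} \<and> (\<exists>p. ideal_fix A = {p})"

definition hyperbolic_cl :: "real^5^5 \<Rightarrow> bool" where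
  "hyperbolic_cl A \<longleftrightarrow> orient_pres A \<and> fixpts A = {} \<and> (\<exists>p q. p \<noteq> q \<and> ideal_fix A = {p, q})"

text \<open>Light-cone coordinates u = x0 - x1, v = x0 + x1, y = (x2,x3,x4); the ideal point
  y of R^3 corresponds to u = 1, v = |y|^2, and infinity to the direction e01.\<close>
definition e01 :: "real^5" where
  "e01 = (\<chi> i. if i = 0 \<or> i = 1 then 1 else 0)"

definition horizontal :: "real^5 \<Rightarrow> bool" where
  "horizontal w \<longleftrightarrow> w$0 = 0 \<and> w$1 = 0"

text \<open>The Poincare extension of the Euclidean translation y \<mapsto> y + b.\<close>
definition ptransl :: "real^5 \<Rightarrow> real^5 \<Rightarrow> real^5" where
  "ptransl b x = x + (x$0 - x$1) *\<^sub>R b + ((2 * (x \<bullet> b) + (x$0 - x$1) * (b \<bullet> b)) / 2) *\<^sub>R e01"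

text \<open>The Poincare extension of the dilation y \<mapsto> l y.\<close>
definition dil :: "real \<Rightarrow> real^5 \<Rightarrow> real^5" where
  "dil l x = (\<chi> i. if i = 0 then ((x$0 - x$1) / l + l * (x$0 + x$1)) / 2
                   else if i = 1 then (l * (x$0 + x$1) - (x$0 - x$1) / l) / 2
                   else x$i)"

definition par_conj :: "real^5^5 \<Rightarrow> real^5^5 \<Rightarrow> real^5 \<Rightarrow> bool" where
  "par_conj A g b \<longleftrightarrow> isom g \<and> horizontal b \<and> b \<noteq> 0 \<and> (\<forall>x. A *v (g *v x) = g *v ptransl b x)"

definition pure_par :: "real^5^5 \<Rightarrow> bool" where
  "pure_par A \<longleftrightarrow> orient_pres A \<and> (\<exists>g b. par_conj A g b)"

definition pure_hyp :: "real^5^5 \<Rightarrow> bool" where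
  "pure_hyp A \<longleftrightarrow> orient_pres A \<and>
     (\<exists>g l. isom g \<and> l > 0 \<and> l \<noteq> 1 \<and> (\<forall>x. A *v (g *v x) = g *v dil l x))"

definition pure_lox :: "real^5^5 \<Rightarrow> bool" where
  "pure_lox A \<longleftrightarrow> hyperbolic_cl A \<and> \<not> pure_hyp A"

definition screw_par :: "real^5^5 \<Rightarrow> bool" where
  "screw_par A \<longleftrightarrow> parabolic A \<and> \<not> pure_par A"

definition axis :: "real^5^5 \<Rightarrow> (real^5) set \<Rightarrow> bool" where
  "axis A L \<longleftrightarrow> is_line L \<and> ideal_bd L = ideal_fix A"

definition F_set :: "real^5^5 \<Rightarrow> (real^5) set set" where
  "F_set A =
     {ideal_bd H | H. is_hyperplane H \<and> type1 A \<and> fixpts A \<subseteq> H}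
   \<union> {ideal_bd H | H. is_hyperplane H \<and> pure_hyp A \<and> (\<exists>L. axis A L \<and> orth_to H L)}
   \<union> {ideal_bd ((\<lambda>x. g *v x) ` hyperplane_of (b + c *\<^sub>R e01)) | g b c.
        pure_par A \<and> par_conj A g b}"

definition T_set :: "real^5^5 \<Rightarrow> (real^5) set set" where
  "T_set A =
     {ideal_bd H | H. is_hyperplane H \<and> type1 A \<and> orth_to H (fixpts A)}
   \<union> {ideal_bd H | H. is_hyperplane H \<and> pure_hyp A \<and> (\<exists>L. axis A L \<and> L \<subseteq> H)}
   \<union> {ideal_bd ((\<lambda>x. g *v x) ` hyperplane_of (w + c *\<^sub>R e01)) | g b w c.
        pure_par A \<and> par_conj A g b \<and> horizontal w \<and> w \<noteq> 0 \<and> w \<bullet> b = 0}"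

definition R_set :: "real^5^5 \<Rightarrow> (real^5) set set" where
  "R_set \<rho> = {ideal_bd H | H. is_hyperplane H \<and> fixpts \<rho> \<subseteq> H}"

definition meet_orth :: "(real^5) set \<Rightarrow> (real^5) set \<Rightarrow> real^5 \<Rightarrow> bool" where
  "meet_orth P1 P2 x \<longleftrightarrow> P1 \<inter> P2 = {x} \<and>
     (\<forall>a\<in>span P1. \<forall>b\<in>span P2. mink a x = 0 \<longrightarrow> mink b x = 0 \<longrightarrow> mink a b = 0)"

definition bank :: "real^5^5 \<Rightarrow> (real^5) set set" where
  "bank A =
     {s \<inter> t | s t. (type1 A \<or> pure_hyp A \<or> pure_par A) \<and> s \<in> F_set A \<and> t \<in> T_set A}
   \<union> {s \<inter> t | s t. (pure_lox A \<or> screw_par A) \<and>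
        (\<exists>\<tau> \<rho>. A = \<tau> ** \<rho> \<and> \<tau> ** \<rho> = \<rho> ** \<tau> \<and> (pure_hyp \<tau> \<or> pure_par \<tau>) \<and> type1 \<rho> \<and>
                s \<in> F_set \<tau> \<and> t \<in> R_set \<rho>)}
   \<union> {s \<inter> t | s t. type2 A \<and> A ** A \<noteq> mat 1 \<and>
        (\<exists>\<rho>1 \<rho>2 x. fixpts A = {x} \<and> A = \<rho>1 ** \<rho>2 \<and> \<rho>1 ** \<rho>2 = \<rho>2 ** \<rho>1 \<and>
                type1 \<rho>1 \<and> type1 \<rho>2 \<and> meet_orth (fixpts \<rho>1) (fixpts \<rho>2) x \<and>
                s \<in> F_set \<rho>1 \<and> t \<in> F_set \<rho>2)}
   \<union> {ideal_bd P | P. type2 A \<and> A ** A = mat 1 \<and> is_plane P \<and> fixpts A \<subseteq> P}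
   \<union> {ideal_bd P | P. A = mat 1 \<and> is_plane P}"

end

theory Submission
  imports Defs
begin

text \<open>A half-turn acts as \<open>-1\<close> on the positive definite normal plane of its fixed plane. A
  singular value decomposition of the pairing between the two normal planes provides orthonormal
  bases \<open>u1, u2\<close> and \<open>v1, v2\<close> with \<open>u1 \<perp> v2\<close> and \<open>u2 \<perp> v1\<close>, so that the product of the half-turns
  is \<open>(refl u1 ** refl v1) ** (refl u2 ** refl v2)\<close> with commuting factors. Each factor is a
  rotation, a pure parabolic, a pure hyperbolic or the identity, according to the size of
  \<open>mink ui vi\<close>; orthogonality of the two spans leaves only the combinations listed in the bank,
  and \<open>P\<close>, \<open>Q\<close> are the intersections of the hyperplanes normal to the \<open>ui\<close> and to the \<open>vi\<close>.\<close>

section \<open>The Minkowski form and reflections\<close>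

text \<open>Replacing \<open>v1\<close> or \<open>v2\<close> by its negative changes neither a
  reflection nor a hyperplane, so both pairings \<open>mink ui vi\<close> may be taken nonnegative,
  and 1 becomes the threshold between the types. If the first pairing exceeds 1, the complement of
  \<open>u1, v1\<close> is positive definite; if it equals 1 with \<open>u1\<close> and
  \<open>v1\<close> distinct, the complement is only semidefinite, with radical spanned by the null
  vector \<open>u1 - v1\<close>. This leaves a single combination of two non-elliptic factors: two
  parabolics with the same null direction. There both singular values are 1, the decomposition is
  not unique, and the basis it gives need not exhibit the product in the form the bank asks for; a
  further common rotation of both bases does. The second obstacle is negative: the clause for
  loxodromic and screw parabolic elements requires that no conjugation whatsoever brings the product
  to a pure normal form. An invariant settles this: a pure element fixes two independent vectors,
  while for a product with a genuine rotation all fixed vectors lie on one line.\<close>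

lemma mink_inner: "mink x y = x \<bullet> y - 2 * x$0 * y$0"
proof -
  have "mink x y = (\<Sum>i\<in>UNIV. x$i * y$i - (if i = 0 then 2 * x$0 * y$0 else 0))"
    unfolding mink_def by (rule sum.cong) (auto simp: eta_def)
  also have "\<dots> = x \<bullet> y - 2 * x$0 * y$0"
    by (simp add: sum_subtractf inner_vec_def)
  finally show ?thesis .
qed

lemma mink_sym: "mink x y = mink y x"
  by (simp add: mink_inner inner_commute)

lemma mink_simps:
  "mink (x + y) z = mink x z + mink y z" "mink z (x + y) = mink z x + mink z y"
  "mink (x - y) z = mink x z - mink y z" "mink z (x - y) = mink z x - mink z y"
  "mink (k *\<^sub>R x) z = k * mink x z" "mink z (k *\<^sub>R x) = k * mink z x"
  "mink (- x) z = - mink x z" "mink z (- x) = - mink z x" "mink 0 z = 0" "mink z 0 = 0"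
  by (simp_all add: mink_inner inner_add_left inner_add_right inner_diff_left inner_diff_right ring_distribs)

lemma mink_nondegenerate:
  assumes "\<And>y. mink x y = 0"
  shows "x = 0"
proof -
  \<comment> \<open>The test vector is \<open>x\<close> with its time coordinate negated, which
    turns the form into the Euclidean norm.\<close>
  have "mink x (x - (2 * x$0) *\<^sub>R Finite_Cartesian_Product.axis 0 1) = x \<bullet> x"
    by (simp add: mink_inner inner_diff_right inner_axis)
  with assms show ?thesis by simp
qed

lemma time_zero_mink:
  assumes "y$0 = 0"
  shows "mink y y \<ge> 0" "mink y y = 0 \<Longrightarrow> y = 0"
  using assms by (simp_all add: mink_inner)

lemma timelike_time_nonzero: "mink z z < 0 \<Longrightarrow> z$0 \<noteq> 0"
  using time_zero_mink(1)[of z] by fastforce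

lemma null_time_nonzero: "mink n n = 0 \<Longrightarrow> n \<noteq> 0 \<Longrightarrow> n$0 \<noteq> 0"
  using time_zero_mink(2)[of n] by blast

text \<open>Subtracting the multiple of \<open>z\<close> that kills the time coordinate of
  \<open>x\<close> leaves a vector of nonnegative norm, and by Pythagoras the norm of
  \<open>x\<close> exceeds that by a positive multiple of \<open>- mink z z\<close>.\<close>

lemma timelike_orth:
  assumes "mink z z < 0" "mink x z = 0" "x \<noteq> 0"
  shows "mink x x > 0"
proof -
  have z0: "z$0 \<noteq> 0" using assms(1) by (rule timelike_time_nonzero)
  define k where "k = x$0 / z$0"
  define y where "y = x - k *\<^sub>R z"
  have y0: "y$0 = 0" by (simp add: y_def k_def z0)
  have eq: "mink y y = mink x x + k\<^sup>2 * mink z z"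
    using assms(2) by (simp add: y_def mink_simps mink_sym[of z x] power2_eq_square)
  show ?thesis
  proof (cases "k = 0")
    case True
    then have "y = x" by (simp add: y_def)
    then show ?thesis using time_zero_mink[OF y0] assms(3) by force
  next
    case False
    then have "k\<^sup>2 * mink z z < 0" using assms(1) by (simp add: mult_less_0_iff)
    then show ?thesis using time_zero_mink(1)[OF y0] eq by linarith
  qed
qed

text \<open>The same subtraction with a null vector does not change the norm at all, so the
  complement of \<open>n\<close> is semidefinite with radical spanned by \<open>n\<close>.\<close>

lemma null_orth:
  assumes "mink n n = 0" "n \<noteq> 0" "mink x n = 0"
  shows "mink x x \<ge> 0" "mink x x = 0 \<Longrightarrow> \<exists>k. x = k *\<^sub>R n"
proof -
  have n0: "n$0 \<noteq> 0" using assms(1,2) by (rule null_time_nonzero)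
  define k where "k = x$0 / n$0"
  define y where "y = x - k *\<^sub>R n"
  have y0: "y$0 = 0" by (simp add: y_def k_def n0)
  have eq: "mink y y = mink x x"
    using assms(1,3) by (simp add: y_def mink_simps mink_sym[of n x])
  show "mink x x \<ge> 0" using time_zero_mink(1)[OF y0] eq by simp
  show "\<exists>k. x = k *\<^sub>R n" if "mink x x = 0"
  proof -
    have "y = 0" using time_zero_mink(2)[OF y0] eq that by simp
    then show ?thesis by (auto simp: y_def)
  qed
qed

text \<open>Decides on which sheet a timelike or null vector lies from its pairing with one point of
  the upper sheet. The inequality is the nonnegativity of the norm of \<open>y - k x\<close>, where
  \<open>k\<close> removes the time coordinate.\<close>

lemma hyp_time_sign:
  assumes "x \<in> hyp" "mink y y \<le> 0" "y$0 \<noteq> 0"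
  shows "y$0 * mink x y < 0"
proof -
  have x: "mink x x = -1" "x$0 > 0" using assms(1) by (auto simp: hyp_def)
  define k where "k = y$0 / x$0"
  define w where "w = y - k *\<^sub>R x"
  have "w$0 = 0" using x by (simp add: w_def k_def)
  then have "mink w w \<ge> 0" by (rule time_zero_mink)
  moreover have "mink w w = mink y y - 2 * k * mink x y - k\<^sup>2"
    by (simp add: w_def mink_simps mink_sym[of y x] x power2_eq_square algebra_simps)
  moreover have "k\<^sup>2 > 0" using assms(3) x by (simp add: k_def)
  ultimately have "k * mink x y < 0" using assms(2) by linarith
  then show ?thesis using x by (simp add: k_def mult_less_0_iff zero_less_divide_iff divide_less_0_iff)
qed

lemma timelike_scale_hyp:
  assumes "mink z z < 0" "z$0 > 0"
  shows "(1 / sqrt (- mink z z)) *\<^sub>R z \<in> hyp"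
  using assms by (simp add: hyp_def mink_simps divide_simps real_sqrt_mult_self)

lemma isomD: "isom A \<Longrightarrow> mink (A *v x) (A *v y) = mink x y"
  by (simp add: isom_def)

lemma isom_hyp: "isom A \<Longrightarrow> x \<in> hyp \<Longrightarrow> A *v x \<in> hyp"
  by (simp add: isom_def)

lemma isom_mult: "isom A \<Longrightarrow> isom B \<Longrightarrow> isom (A ** B)"
  by (simp add: isom_def flip: matrix_vector_mul_assoc)

lemma orient_pres_mult: "orient_pres A \<Longrightarrow> orient_pres B \<Longrightarrow> orient_pres (A ** B)"
  by (simp add: orient_pres_def isom_mult det_mul)

lemma isom_one: "isom (mat 1)"
  by (simp add: isom_def)

lemma isom_inj:
  assumes "isom g" "g *v x = g *v y"
  shows "x = y"
proof -
  have "mink (x - y) z = 0" for z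
    using isomD[OF assms(1), of "x - y" z] assms(2)
    by (simp add: matrix_vector_mult_diff_distrib mink_simps)
  then have "x - y = 0" by (rule mink_nondegenerate)
  then show ?thesis by simp
qed

lemma refl_apply: "refl n *v x = x - (2 * mink x n / mink n n) *\<^sub>R n"
proof (subst vec_eq_iff, rule allI)
  fix i
  have "(refl n *v x)$i = (\<Sum>j\<in>UNIV. (if i = j then x$j else 0) - (2 * n$i / mink n n) * (eta j * x$j * n$j))"
    unfolding matrix_vector_mult_def refl_def
    by (simp, rule sum.cong) (auto simp: algebra_simps)
  also have "\<dots> = x$i - (2 * n$i / mink n n) * mink x n"
    unfolding sum_subtractf mink_def[of x n] sum_distrib_left by simp
  finally show "(refl n *v x)$i = (x - (2 * mink x n / mink n n) *\<^sub>R n)$i"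
    by (simp add: algebra_simps)
qed

lemma refl_unit: "mink n n = 1 \<Longrightarrow> refl n *v x = x - (2 * mink x n) *\<^sub>R n"
  by (simp add: refl_apply)

lemma refl_scale: "k \<noteq> 0 \<Longrightarrow> refl (k *\<^sub>R n) = refl n"
  by (simp add: refl_def mink_simps vec_eq_iff)

lemma mink_refl: "mink n n \<noteq> 0 \<Longrightarrow> mink (refl n *v x) (refl n *v y) = mink x y"
  by (simp add: refl_apply mink_simps mink_sym[of n y])

lemma refl_involutive: "mink n n \<noteq> 0 \<Longrightarrow> refl n *v (refl n *v x) = x"
  by (simp add: refl_apply mink_simps)

lemma refl_square: "mink n n \<noteq> 0 \<Longrightarrow> refl n ** refl n = mat 1"
  by (simp add: matrix_eq refl_involutive flip: matrix_vector_mul_assoc)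

lemma isom_refl:
  assumes "mink n n > 0"
  shows "isom (refl n)"
proof -
  have "refl n *v x \<in> hyp" if x: "x \<in> hyp" for x
  proof -
    let ?y = "refl n *v x"
    have yy: "mink ?y ?y = -1" using x assms by (simp add: mink_refl hyp_def)
    have y0: "?y$0 \<noteq> 0" by (rule timelike_time_nonzero) (simp add: yy)
    \<comment> \<open>Only the preservation of the upper sheet is at stake; a negative pairing with
      \<open>x\<close> forces a positive time coordinate.\<close>
    have "mink x ?y = -1 - 2 * (mink x n)\<^sup>2 / mink n n"
      using x assms by (simp add: refl_apply mink_simps hyp_def power2_eq_square)
    also have "\<dots> < 0"
    proof -
      have "2 * (mink x n)\<^sup>2 / mink n n \<ge> 0" using assms by simp
      then show ?thesis by linarith
    qed
    finally have "?y$0 > 0"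
      using hyp_time_sign[OF x _ y0] yy by (simp add: mult_less_0_iff)
    then show ?thesis using yy by (simp add: hyp_def)
  qed
  then show ?thesis using assms by (simp add: isom_def mink_refl)
qed

lemma refl_conj:
  assumes "mink n n \<noteq> 0" "mink m m \<noteq> 0"
  shows "refl m ** refl n ** refl m = refl (refl m *v n)"
proof -
  have "refl m *v (refl n *v (refl m *v x)) = refl (refl m *v n) *v x" for x
  proof -
    have "mink (refl m *v x) n = mink x (refl m *v n)"
      using mink_refl[OF assms(2), of "refl m *v x" n] by (simp add: refl_involutive assms(2))
    then show ?thesis
      by (simp add: refl_apply[of n] refl_apply[of "refl m *v n"] mink_refl assms
          matrix_vector_mult_diff_distrib matrix_vector_mult_scaleR refl_involutive)
  qed
  then show ?thesis by (simp add: matrix_eq flip: matrix_vector_mul_assoc)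
qed

lemma refl_swap:
  assumes "mink p p = mink q q" "mink (p - q) (p - q) \<noteq> 0"
  shows "refl (p - q) *v p = q"
proof -
  have "mink (p - q) (p - q) = 2 * mink p (p - q)"
    using assms(1) by (simp add: mink_simps mink_sym[of q p])
  then show ?thesis using assms(2) by (simp add: refl_apply)
qed

text \<open>Reflections in unit vectors \<open>u\<close>, \<open>v\<close> are conjugate through the reflection in
  \<open>u - v\<close> or \<open>u + v\<close>, so they have the same determinant.\<close>
lemma det_refl_refl:
  assumes "mink u u = 1" "mink v v = 1"
  shows "det (refl u) * det (refl v) = 1"
proof -
  have sq: "det (refl n) * det (refl n) = 1" if "mink n n \<noteq> 0" for n
    using refl_square[OF that] by (metis det_mul det_I)
  have neg: "refl (- v) = refl v" using refl_scale[of "-1" v] by simp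
  have *: "det (refl u) = det (refl w)"
    if "mink w w = 1" "mink (u - w) (u - w) \<noteq> 0" for w
  proof -
    have "refl w = refl (u - w) ** refl u ** refl (u - w)"
      using refl_conj[of u "u - w"] refl_swap[of u w] assms that by simp
    then have "det (refl w) = det (refl (u - w)) * det (refl (u - w)) * det (refl u)"
      by (simp add: det_mul)
    then show ?thesis using sq[OF that(2)] by simp
  qed
  \<comment> \<open>By the parallelogram identity \<open>u - v\<close> and \<open>u + v\<close>
    cannot both be null, so one of the two conjugations is available.\<close>
  have "mink (u - v) (u - v) + mink (u - - v) (u - - v) = 4"
    using assms by (simp add: mink_simps mink_sym[of v u])
  then have "mink (u - v) (u - v) \<noteq> 0 \<or> mink (u - - v) (u - - v) \<noteq> 0" by linarith
  then have "det (refl u) = det (refl v)"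
    using *[of v] *[of "- v"] assms(2) neg by (metis mink_simps(7,8) minus_minus)
  then show ?thesis using sq[of v] assms by simp
qed

lemma orient_pres_refl_refl:
  assumes "mink u u = 1" "mink v v = 1"
  shows "orient_pres (refl u ** refl v)"
  using assms by (simp add: orient_pres_def isom_mult isom_refl det_mul det_refl_refl)

section \<open>Orthogonal complements for the Minkowski form\<close>

definition perp :: "(real^5) set \<Rightarrow> (real^5) set" where
  "perp S = {x. \<forall>s\<in>S. mink x s = 0}"

lemma subspace_perp: "subspace (perp S)"
  by (simp add: subspace_def perp_def mink_simps)

lemma perp_span: "perp (span S) = perp S"
proof -
  have "mink x s = 0" if "x \<in> perp S" "s \<in> span S" for x s
    using that(2) by (induction rule: span_induct_alt) (use that(1) in \<open>auto simp: perp_def mink_simps\<close>)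
  then have "perp S \<subseteq> perp (span S)" by (simp add: perp_def subset_iff)
  moreover have "perp (span S) \<subseteq> perp S"
    unfolding perp_def using span_superset[of S] by blast
  ultimately show ?thesis by blast
qed

text \<open>Negating the time coordinate (\<open>J\<close>) turns Minkowski orthogonality into
  Euclidean orthogonality, for which the dimension formula is known.\<close>

lemma dim_perp: "dim (perp S) + dim S = 5"
proof -
  define J where "J = (\<lambda>x::real^5. x - (2 * x$0) *\<^sub>R Finite_Cartesian_Product.axis 0 1)"
  have lin: "linear J"
    by (rule linearI) (simp_all add: J_def scaleR_add_left scaleR_add_right scaleR_diff_right)
  have inv: "J (J x) = x" for x by (simp add: J_def Finite_Cartesian_Product.axis_def vec_eq_iff)
  have mJ: "mink x s = J s \<bullet> x" for x s
    by (simp add: J_def mink_inner inner_diff_left inner_axis' inner_commute[of x s])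
  have eq: "perp S = {y \<in> UNIV. \<forall>x\<in>J ` span S. orthogonal x y}"
    by (subst perp_span[of S, symmetric]) (auto simp: perp_def orthogonal_def mJ)
  have sub: "subspace (J ` span S)"
    by (rule linear_subspace_image[OF lin subspace_span])
  have "dim (perp S) + dim (J ` span S) = dim (UNIV :: (real^5) set)"
    unfolding eq by (rule dim_subspace_orthogonal_to_vectors[OF sub subspace_UNIV subset_UNIV])
  moreover have "dim (J ` span S) = dim (span S)"
    by (rule dim_image_eq[OF lin]) (rule inj_on_inverseI[of _ J], rule inv)
  ultimately show ?thesis by simp
qed

text \<open>The independence test behind all later dimension counts: a vector orthogonal to
  \<open>S\<close> but not to \<open>a\<close> separates \<open>a\<close> from the span.\<close>

lemma notin_span_perp:
  assumes "w \<in> perp S" "mink a w \<noteq> 0"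
  shows "a \<notin> span S"
proof
  assume "a \<in> span S"
  then have "mink w a = 0" using assms(1) perp_span[of S] unfolding perp_def by blast
  then show False using assms(2) by (simp add: mink_sym)
qed

section \<open>Hyperbolic subspaces and light-cone coordinates\<close>

text \<open>Removing the component along a spacelike vector can only decrease the norm. The last
  conclusion says that orthogonality to other vectors survives, so the projection can be iterated as
  in Gram-Schmidt.\<close>

lemma timelike_project:
  assumes "mink z z < 0" "mink a a > 0"
  obtains z' where "mink z' z' < 0" "mink z' a = 0"
    "\<And>s. mink z s = 0 \<Longrightarrow> mink a s = 0 \<Longrightarrow> mink z' s = 0"
proof
  define z' where "z' = z - (mink z a / mink a a) *\<^sub>R a"
  have "mink z' z' = mink z z - (mink z a)\<^sup>2 / mink a a"
    using assms(2) by (simp add: z'_def mink_simps mink_sym[of a z] power2_eq_square)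
  also have "\<dots> < 0"
  proof -
    have "(mink z a)\<^sup>2 / mink a a \<ge> 0" using assms(2) by simp
    then show ?thesis using assms(1) by linarith
  qed
  finally show "mink z' z' < 0" .
  show "mink z' a = 0" using assms(2) by (simp add: z'_def mink_simps)
  show "mink z' s = 0" if "mink z s = 0" "mink a s = 0" for s
    using that by (simp add: z'_def mink_simps)
qed

lemma timelike_exists: obtains z where "mink z z < 0"
proof
  show "mink (Finite_Cartesian_Product.axis 0 1) (Finite_Cartesian_Product.axis 0 1) < 0"
    by (simp add: mink_inner inner_axis_axis)
qed

lemma timelike_perp1:
  assumes "mink a a > 0"
  obtains z where "mink z z < 0" "mink z a = 0"
  by (meson timelike_exists timelike_project[OF _ assms])

lemma timelike_perp2:
  assumes "mink a a > 0" "mink b b > 0" "mink a b = 0"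
  obtains z where "mink z z < 0" "mink z a = 0" "mink z b = 0"
  by (metis assms timelike_perp1[OF assms(1)] timelike_project[OF _ assms(2)] mink_sym)

lemma subspace_meets_hyp:
  assumes "subspace W" "z \<in> W" "mink z z < 0"
  shows "W \<inter> hyp \<noteq> {}"
proof -
  define y where "y = sgn (z$0) *\<^sub>R z"
  have z0: "z$0 \<noteq> 0" using assms(3) by (rule timelike_time_nonzero)
  have "mink y y < 0"
    using assms(3) z0 by (simp add: y_def mink_simps sgn_if)
  moreover have "y$0 > 0" using z0 by (simp add: y_def sgn_if)
  ultimately have "(1 / sqrt (- mink y y)) *\<^sub>R y \<in> hyp" by (rule timelike_scale_hyp)
  moreover have "(1 / sqrt (- mink y y)) *\<^sub>R y \<in> W"
    using assms(1,2) by (simp add: y_def subspace_scale)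
  ultimately show ?thesis by blast
qed

lemma gsubI:
  assumes "subspace W" "dim W = k + 1" "z \<in> W" "mink z z < 0" "S = W \<inter> hyp"
  shows "gsub k S"
  using subspace_meets_hyp[OF assms(1,3,4)] assms unfolding gsub_def by blast

text \<open>Being timelike with positive time coordinate is an open condition: for small
  \<open>e\<close> the vector \<open>x + e w\<close> can be rescaled into the hyperboloid, and
  \<open>w\<close> is recovered as a difference quotient.\<close>

lemma span_subspace_hyp:
  assumes "subspace W" "z \<in> W" "mink z z < 0"
  shows "span (W \<inter> hyp) = W"
proof
  show "span (W \<inter> hyp) \<subseteq> W" using assms(1) by (simp add: span_minimal)
  obtain x where x: "x \<in> W" "x \<in> hyp" using subspace_meets_hyp[OF assms] by blast
  then have xx: "mink x x = -1" "x$0 > 0" by (auto simp: hyp_def)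
  show "W \<subseteq> span (W \<inter> hyp)"
  proof
    fix w assume w: "w \<in> W"
    have "((\<lambda>e. -1 + 2 * e * mink x w + e * e * mink w w) \<longlongrightarrow> -1 + 2 * 0 * mink x w + 0 * 0 * mink w w)
        (at_right 0)"
      by (intro tendsto_intros)
    then have "\<forall>\<^sub>F e in at_right 0. -1 + 2 * e * mink x w + e * e * mink w w < 0"
      by (rule order_tendstoD) simp
    moreover have "((\<lambda>e. x$0 + e * w$0) \<longlongrightarrow> x$0 + 0 * w$0) (at_right 0)"
      by (intro tendsto_intros)
    then have "\<forall>\<^sub>F e in at_right 0. x$0 + e * w$0 > 0"
      by (rule order_tendstoD) (simp add: xx)
    ultimately have "\<forall>\<^sub>F e in at_right (0::real). e > 0 \<and>
        -1 + 2 * e * mink x w + e * e * mink w w < 0 \<and> x$0 + e * w$0 > 0"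
      using eventually_at_right_less[of "0::real"] by eventually_elim blast
    then obtain e where e: "e > 0" "-1 + 2 * e * mink x w + e * e * mink w w < 0" "x$0 + e * w$0 > 0"
      using eventually_happens'[OF trivial_limit_at_right_real] by blast
    define y where "y = x + e *\<^sub>R w"
    have yW: "y \<in> W" using x w assms(1) by (simp add: y_def subspace_add subspace_scale)
    have yy: "mink y y < 0" "y$0 > 0"
      using e by (simp_all add: y_def mink_simps mink_sym[of w x] xx algebra_simps)
    have "(1 / sqrt (- mink y y)) *\<^sub>R y \<in> W \<inter> hyp"
      using timelike_scale_hyp[OF yy] yW assms(1) by (simp add: subspace_scale)
    then have "sqrt (- mink y y) *\<^sub>R ((1 / sqrt (- mink y y)) *\<^sub>R y) \<in> span (W \<inter> hyp)"
      by (intro span_scale span_base)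
    then have "y \<in> span (W \<inter> hyp)" using yy by simp
    moreover have "x \<in> span (W \<inter> hyp)" using x by (simp add: span_base)
    ultimately have "(1 / e) *\<^sub>R (y - x) \<in> span (W \<inter> hyp)"
      by (intro span_scale span_diff)
    then show "w \<in> span (W \<inter> hyp)" using e by (simp add: y_def)
  qed
qed

lemma ideal_bd_subspace:
  assumes W: "subspace W" and z: "z \<in> W" "mink z z < 0"
  shows "ideal_bd (W \<inter> hyp) = W \<inter> ideal"
proof -
  let ?K = "(\<lambda>x. (1 / x$0) *\<^sub>R x) ` (W \<inter> hyp)"
  have "?K \<subseteq> W" using W by (auto simp: subspace_scale)
  then have "closure ?K \<subseteq> W" by (rule closure_minimal) (rule closed_subspace[OF W])
  moreover have "\<xi> \<in> closure ?K" if \<xi>: "\<xi> \<in> W" "\<xi> \<in> ideal" for \<xi>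
  proof -
    have n: "mink \<xi> \<xi> = 0" "\<xi>$0 = 1" using \<xi> by (auto simp: ideal_def)
    obtain x where x: "x \<in> W" "x \<in> hyp" using subspace_meets_hyp[OF assms] by blast
    have x0: "mink x x = -1" "x$0 > 0" using x by (auto simp: hyp_def)
    have neg: "mink x \<xi> < 0" using hyp_time_sign[OF x(2), of \<xi>] n by simp
    define k where "k = (1 / x$0) *\<^sub>R x"
    have k: "mink k k < 0" "k$0 = 1" "mink k \<xi> < 0" "k \<in> W"
      using x0 neg x W by (simp_all add: k_def mink_simps subspace_scale divide_simps)
    \<comment> \<open>In the Klein model the boundary point is approached along the segment towards
      the interior point \<open>k\<close>; all its points have time coordinate 1 and are timelike
      for positive \<open>t\<close>.\<close>
    define y where "y t = (1 - t) *\<^sub>R \<xi> + t *\<^sub>R k" for t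
    have "y t \<in> ?K" if t: "0 < t" "t \<le> 1" for t
    proof -
      have y0: "y t $ 0 = 1" by (simp add: y_def n k)
      have "mink (y t) (y t) = 2 * t * (1 - t) * mink k \<xi> + t * t * mink k k"
        by (simp add: y_def mink_simps n mink_sym[of \<xi> k] algebra_simps)
      also have "\<dots> < 0"
      proof -
        have "2 * t * (1 - t) * mink k \<xi> \<le> 0" using t k by (simp add: mult_nonneg_nonpos)
        moreover have "t * t * mink k k < 0" using t k by (simp add: mult_pos_neg)
        ultimately show ?thesis by linarith
      qed
      finally have yt: "mink (y t) (y t) < 0" .
      define h where "h = (1 / sqrt (- mink (y t) (y t))) *\<^sub>R y t"
      have "h \<in> hyp" using timelike_scale_hyp[OF yt] y0 by (simp add: h_def)
      moreover have "y t \<in> W" using W \<xi> k by (simp add: y_def subspace_add subspace_scale)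
      then have "h \<in> W" using W by (simp add: h_def subspace_scale)
      moreover have "(1 / h$0) *\<^sub>R h = y t" using yt y0 by (simp add: h_def)
      ultimately show ?thesis by (intro image_eqI[of _ _ h]) auto
    qed
    moreover have "0 < inverse (real (Suc i))" "inverse (real (Suc i)) \<le> 1" for i
      by (simp_all add: inverse_le_1_iff)
    ultimately have "\<forall>i. y (inverse (real (Suc i))) \<in> ?K"
      by blast
    moreover have "(\<lambda>i. y (inverse (real (Suc i)))) \<longlonglongrightarrow> (1 - 0) *\<^sub>R \<xi> + 0 *\<^sub>R k"
      unfolding y_def by (intro tendsto_intros LIMSEQ_inverse_real_of_nat)
    ultimately show ?thesis
      unfolding closure_sequential by (intro exI[of _ "\<lambda>i. y (inverse (real (Suc i)))"]) simp
  qed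
  ultimately show ?thesis unfolding ideal_bd_def by blast
qed

lemma hyperplane_of_perp: "hyperplane_of n = perp {n} \<inter> hyp"
  by (auto simp: hyperplane_of_def perp_def)

lemma dim_perp1: "mink n n \<noteq> 0 \<Longrightarrow> dim (perp {n}) = 4"
  using dim_perp[of "{n}"] by (cases "n = 0") (auto simp: mink_simps)

lemma ideal_bd_hyperplane:
  assumes "mink n n > 0"
  shows "ideal_bd (hyperplane_of n) = perp {n} \<inter> ideal"
proof -
  obtain z where "mink z z < 0" "mink z n = 0" using timelike_perp1[OF assms] .
  then show ?thesis unfolding hyperplane_of_perp
    by (intro ideal_bd_subspace[OF subspace_perp]) (auto simp: perp_def)
qed

lemma is_hyperplane_of:
  assumes "mink n n > 0"
  shows "is_hyperplane (hyperplane_of n)"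
proof -
  obtain z where "mink z z < 0" "mink z n = 0" using timelike_perp1[OF assms] .
  then show ?thesis
    using assms dim_perp1[of n]
    by (intro gsubI[OF subspace_perp[of "{n}"], of _ z]) (auto simp: perp_def hyperplane_of_perp)
qed

lemma ideal_bd_Int_hyperplanes:
  assumes "mink u u > 0" "mink w w > 0" "mink u w = 0"
  shows "ideal_bd (hyperplane_of u \<inter> hyperplane_of w)
    = ideal_bd (hyperplane_of u) \<inter> ideal_bd (hyperplane_of w)"
proof -
  obtain z where "mink z z < 0" "mink z u = 0" "mink z w = 0" using timelike_perp2[OF assms] .
  moreover have eq: "hyperplane_of u \<inter> hyperplane_of w = perp {u, w} \<inter> hyp"
    by (auto simp: hyperplane_of_def perp_def)
  ultimately have "ideal_bd (perp {u, w} \<inter> hyp) = perp {u, w} \<inter> ideal"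
    by (intro ideal_bd_subspace[OF subspace_perp]) (auto simp: perp_def)
  then show ?thesis unfolding eq ideal_bd_hyperplane[OF assms(1)] ideal_bd_hyperplane[OF assms(2)]
    by (auto simp: perp_def)
qed

text \<open>If \<open>mink p q\<close> is negative, then \<open>p - q\<close> is spacelike and its
  reflection does everything; if \<open>p = q\<close>, the identity does. The last clause lets a
  second swap leave an already normalised null vector in place.\<close>

lemma isom_null_swap:
  assumes "mink p p = 0" "mink q q = 0" "mink p q < 0 \<or> p = q"
  shows "\<exists>g. isom g \<and> g *v p = q \<and> (\<forall>x. g *v (g *v x) = x) \<and>
    (\<forall>x. mink x p = mink x q \<longrightarrow> g *v x = x)"
proof (cases "p = q")
  case True
  then show ?thesis by (intro exI[of _ "mat 1"]) (simp add: isom_one)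
next
  case False
  have pos: "mink (p - q) (p - q) > 0"
    using assms False by (simp add: mink_simps mink_sym[of q p])
  then have "refl (p - q) *v p = q" using assms by (intro refl_swap) auto
  then show ?thesis
    using pos by (intro exI[of _ "refl (p - q)"])
      (simp add: isom_refl refl_involutive, simp add: refl_apply mink_simps)
qed

lemma mink_ideal:
  assumes "p \<in> ideal" "q \<in> ideal"
  shows "mink p q < 0 \<or> p = q"
proof -
  have *: "mink p p = 0" "mink q q = 0" "(p - q)$0 = 0" using assms by (auto simp: ideal_def)
  have "mink (p - q) (p - q) = - 2 * mink p q"
    by (simp add: mink_simps * mink_sym[of q p])
  then show ?thesis using time_zero_mink[OF *(3)] by force
qed

text \<open>The null direction of the origin of R^3, paired with \<open>e01\<close>, the direction
  of infinity.\<close>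

definition f01 :: "real^5" where
  "f01 = (\<chi> i. if i = 0 then 1 else if i = 1 then -1 else 0)"

definition hpart :: "real^5 \<Rightarrow> real^5" where
  "hpart x = (\<chi> i. if i = 0 \<or> i = 1 then 0 else x$i)"

lemma e01_axis: "e01 = Finite_Cartesian_Product.axis 0 1 + Finite_Cartesian_Product.axis 1 1"
  by (simp add: e01_def Finite_Cartesian_Product.axis_def vec_eq_iff)

lemma f01_axis: "f01 = Finite_Cartesian_Product.axis 0 1 - Finite_Cartesian_Product.axis 1 1"
  by (simp add: f01_def Finite_Cartesian_Product.axis_def vec_eq_iff)

lemma e01_nth [simp]: "e01$0 = 1" "e01$1 = 1" and f01_nth [simp]: "f01$0 = 1" "f01$1 = -1"
  by (simp_all add: e01_def f01_def)

lemma mink_e01: "mink x e01 = x$1 - x$0"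
  by (simp add: mink_inner) (simp add: e01_axis inner_add_right inner_axis)

lemma mink_f01: "mink x f01 = - x$0 - x$1"
  by (simp add: mink_inner) (simp add: f01_axis inner_diff_right inner_axis)

lemma light_cone_decomp:
  "x = ((x$0 + x$1) / 2) *\<^sub>R e01 + ((x$0 - x$1) / 2) *\<^sub>R f01 + hpart x"
  by (simp add: vec_eq_iff e01_def f01_def hpart_def field_simps)

lemma dil_decomp:
  "dil l x = (l * ((x$0 + x$1) / 2)) *\<^sub>R e01 + ((x$0 - x$1) / 2 / l) *\<^sub>R f01 + hpart x"
  by (simp add: vec_eq_iff e01_def f01_def hpart_def dil_def diff_divide_distrib add_divide_distrib algebra_simps)

text \<open>Two swaps: \<open>g1\<close> carries \<open>e01\<close> to the direction of
  \<open>p\<close>, and \<open>g2\<close>, applied before it, moves \<open>f01\<close> while fixing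
  \<open>e01\<close>.\<close>

lemma isom_to_null_pair:
  assumes "mink p p = 0" "mink q q = 0" "mink p q \<noteq> 0"
  obtains g a b where "isom g" "g *v e01 = a *\<^sub>R p" "g *v f01 = b *\<^sub>R q"
proof -
  have ne: "p \<noteq> 0" "q \<noteq> 0" using assms(3) by (auto simp: mink_simps)
  define p' where "p' = (1 / p$0) *\<^sub>R p"
  have p0: "p$0 \<noteq> 0" using null_time_nonzero assms(1) ne by blast
  have "p' \<in> ideal" "e01 \<in> ideal"
    using assms p0 by (auto simp: ideal_def p'_def mink_simps mink_e01)
  then have e: "mink e01 e01 = 0" "mink p' p' = 0" "mink e01 p' < 0 \<or> e01 = p'"
    using mink_ideal[of e01 p'] by (auto simp: ideal_def)
  obtain g1 where g1: "isom g1" "g1 *v e01 = p'" "\<And>x. g1 *v (g1 *v x) = x"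
    using isom_null_swap[OF e] by blast
  define r where "r = g1 *v q"
  have er: "mink e01 r = mink p' q" using isomD[OF g1(1), of e01 r] g1 by (simp add: r_def)
  have rn: "mink r r = 0" using isomD[OF g1(1), of q q] assms by (simp add: r_def)
  have pq: "mink p' q \<noteq> 0" using assms(3) p0 by (simp add: p'_def mink_simps)
  \<comment> \<open>The scale gives \<open>q'\<close> the same pairing with \<open>e01\<close> as
    \<open>f01\<close> has, namely -2. Hence \<open>f01 - q'\<close> is orthogonal to
    \<open>e01\<close>, which makes \<open>g2\<close> fix \<open>e01\<close> and, through
    \<open>null_orth\<close>, yields the sign needed for the swap.\<close>
  define k where "k = - 2 / mink p' q"
  define q' where "q' = k *\<^sub>R r"
  have q': "mink e01 q' = -2" "mink q' q' = 0"
    using pq er rn by (simp_all add: q'_def k_def mink_simps)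
  have ef: "mink e01 f01 = -2" "mink f01 f01 = 0" "mink e01 e01 = 0" "e01 \<noteq> 0"
    using e01_nth(1) by (simp_all add: mink_f01 mink_e01 vec_eq_iff) (rule exI[of _ 0], simp)
  have o: "mink (f01 - q') e01 = 0"
    using ef(1) q'(1) mink_sym[of f01 e01] mink_sym[of q' e01] by (simp add: mink_simps(3))
  have sq: "mink (f01 - q') (f01 - q') = - 2 * mink f01 q'"
    using ef q' by (simp add: mink_simps mink_sym[of q' f01])
  have fq: "mink f01 q' < 0 \<or> f01 = q'"
  proof (cases "mink f01 q' = 0")
    case True
    then obtain c where c: "f01 - q' = c *\<^sub>R e01"
      using null_orth(2)[OF ef(3,4) o] sq by auto
    have "c * mink e01 f01 = 0"
      using True ef mink_simps(5)[of c e01 f01] by (simp add: c[symmetric] mink_simps mink_sym[of q'])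
    then show ?thesis using c ef by simp
  next
    case False
    then show ?thesis using null_orth(1)[OF ef(3,4) o] sq by linarith
  qed
  obtain g2 where g2: "isom g2" "g2 *v f01 = q'" "\<And>x. g2 *v (g2 *v x) = x"
      "\<And>x. mink x f01 = mink x q' \<Longrightarrow> g2 *v x = x"
    using isom_null_swap[OF ef(2) q'(2) fq] by blast
  show ?thesis
  proof (rule that)
    show "isom (g1 ** g2)" using g1 g2 by (simp add: isom_mult)
    have "g2 *v e01 = e01" using g2(4) ef q' by simp
    then show "(g1 ** g2) *v e01 = (1 / p$0) *\<^sub>R p"
      using g1 by (simp add: p'_def flip: matrix_vector_mul_assoc)
    show "(g1 ** g2) *v f01 = k *\<^sub>R q"
      using g2(2) g1(3) by (simp add: q'_def r_def matrix_vector_mult_scaleR flip: matrix_vector_mul_assoc)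
  qed
qed

text \<open>In the chart that sends \<open>e01, f01\<close> to \<open>p, q\<close>, the horizontal
  part lands in the complement of \<open>p, q\<close>, where \<open>A\<close> is trivial; on the two
  null directions \<open>A\<close> acts as the dilation does.\<close>

lemma pure_hypI:
  assumes A: "orient_pres A" and l: "l > 0" "l \<noteq> 1"
    and pq: "mink p p = 0" "mink q q = 0" "mink p q \<noteq> 0"
    and eig: "A *v p = l *\<^sub>R p" "A *v q = (1 / l) *\<^sub>R q"
    and fix_perp: "\<And>x. mink x p = 0 \<Longrightarrow> mink x q = 0 \<Longrightarrow> A *v x = x"
  shows "pure_hyp A"
proof -
  obtain g a b where g: "isom g" "g *v e01 = a *\<^sub>R p" "g *v f01 = b *\<^sub>R q"
    using isom_to_null_pair[OF pq] .
  have "mink (g *v e01) (g *v f01) \<noteq> 0"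
    unfolding isomD[OF g(1)] by (simp add: mink_f01)
  then have ab: "a \<noteq> 0" "b \<noteq> 0" using g by (auto simp: mink_simps)
  have "A *v (g *v x) = g *v dil l x" for x
  proof -
    have "mink (hpart x) e01 = 0" "mink (hpart x) f01 = 0"
      by (simp_all add: mink_e01 mink_f01 hpart_def)
    then have "mink (g *v hpart x) (a *\<^sub>R p) = 0" "mink (g *v hpart x) (b *\<^sub>R q) = 0"
      by (simp_all add: isomD[OF g(1)] flip: g(2,3))
    then have h: "A *v (g *v hpart x) = g *v hpart x"
      using ab fix_perp by (simp add: mink_simps)
    have "A *v (g *v x) = A *v (g *v (((x$0 + x$1) / 2) *\<^sub>R e01 + ((x$0 - x$1) / 2) *\<^sub>R f01 + hpart x))"
      by (subst light_cone_decomp[of x]) simp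
    also have "\<dots> = g *v dil l x"
      by (simp add: dil_decomp matrix_vector_right_distrib matrix_vector_mult_scaleR g h eig mult.commute)
    finally show ?thesis .
  qed
  then show ?thesis using A l g(1) unfolding pure_hyp_def by blast
qed

section \<open>Products of two reflections\<close>

lemma refl_refl_apply:
  assumes "mink u u = 1" "mink v v = 1"
  shows "(refl u ** refl v) *v x
    = x - (2 * mink x v) *\<^sub>R v - (2 * (mink x u - 2 * mink x v * mink v u)) *\<^sub>R u"
  using assms by (simp add: refl_unit mink_simps flip: matrix_vector_mul_assoc)

lemma refl_refl_fixed:
  assumes "mink x u = 0" "mink x v = 0"
  shows "(refl u ** refl v) *v x = x"
  using assms by (simp add: refl_apply flip: matrix_vector_mul_assoc)

section \<open>Recognising hyperbolic and parabolic elements from null eigenvectors\<close>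

lemma ideal_normalize:
  assumes "mink n n = 0" "n \<noteq> 0"
  shows "(1 / n$0) *\<^sub>R n \<in> ideal"
  using assms null_time_nonzero[OF assms] by (simp add: ideal_def mink_simps)

lemma ideal_unique:
  assumes "\<xi> \<in> ideal" "\<xi> = k *\<^sub>R n"
  shows "\<xi> = (1 / n$0) *\<^sub>R n"
proof -
  have "k * n$0 = 1" using assms by (simp add: ideal_def)
  then have "k = 1 / n$0" by (metis mult_zero_right nonzero_eq_divide_eq zero_neq_one)
  then show ?thesis using assms(2) by simp
qed

lemma hyp_not_orth_null:
  assumes "x \<in> hyp" "mink n n = 0" "n \<noteq> 0"
  shows "mink x n \<noteq> 0"
  using timelike_orth[of x n] assms mink_sym[of x n] by (auto simp: hyp_def)

text \<open>Nothing is assumed about the action on the complement of \<open>p, q\<close>, so the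
  locale serves both a pure hyperbolic factor and its product with a commuting rotation.\<close>

locale hyperbolic_eig =
  fixes B :: "real^5^5" and p q :: "real^5" and l :: real
  assumes isom: "isom B" and pos: "l > 0" and ne1: "l \<noteq> 1"
    and pp: "mink p p = 0" and qq: "mink q q = 0" and pq: "mink p q \<noteq> 0"
    and Bp: "B *v p = l *\<^sub>R p" and Bq: "B *v q = (1 / l) *\<^sub>R q"
begin

lemma p_ne: "p \<noteq> 0" and q_ne: "q \<noteq> 0"
  using pq by (auto simp: mink_simps)

lemma fixpts_empty: "fixpts B = {}"
proof -
  have False if "x \<in> hyp" "B *v x = x" for x
  proof -
    have "mink x p = l * mink x p"
      using isomD[OF isom, of x p] that(2) Bp by (simp add: mink_simps)
    then show False using ne1 hyp_not_orth_null[OF that(1) pp p_ne] by simp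
  qed
  then show ?thesis by (auto simp: fixpts_def)
qed

lemma ideal_fix_eq: "ideal_fix B = {(1 / p$0) *\<^sub>R p, (1 / q$0) *\<^sub>R q}"
proof
  show "{(1 / p$0) *\<^sub>R p, (1 / q$0) *\<^sub>R q} \<subseteq> ideal_fix B"
  proof -
    have "B *v ((1 / p$0) *\<^sub>R p) = l *\<^sub>R ((1 / p$0) *\<^sub>R p)"
      "B *v ((1 / q$0) *\<^sub>R q) = (1 / l) *\<^sub>R ((1 / q$0) *\<^sub>R q)"
      by (simp_all add: matrix_vector_mult_scaleR Bp Bq)
    moreover have "1 / l > 0" using pos by simp
    ultimately show ?thesis
      using ideal_normalize[OF pp p_ne] ideal_normalize[OF qq q_ne] pos
      unfolding ideal_fix_def by blast
  qed
  show "ideal_fix B \<subseteq> {(1 / p$0) *\<^sub>R p, (1 / q$0) *\<^sub>R q}"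
  proof
    fix \<xi> assume "\<xi> \<in> ideal_fix B"
    then obtain k where k: "\<xi> \<in> ideal" "B *v \<xi> = k *\<^sub>R \<xi>" by (auto simp: ideal_fix_def)
    then have null: "mink \<xi> \<xi> = 0" by (simp add: ideal_def)
    \<comment> \<open>Unless \<open>\<xi>\<close> is orthogonal to one of \<open>p\<close>,
      \<open>q\<close>, invariance gives \<open>k l = 1\<close> and \<open>k = l\<close>, which is
      impossible. A null vector orthogonal to a null vector is a multiple of it.\<close>
    have "mink \<xi> p = k * l * mink \<xi> p"
      using isomD[OF isom, of \<xi> p] k Bp by (simp add: mink_simps mult.commute)
    moreover have "mink \<xi> q = k * (1 / l) * mink \<xi> q"
      using isomD[OF isom, of \<xi> q] k Bq by (simp add: mink_simps)
    moreover have "\<not> (k * l = 1 \<and> k * (1 / l) = 1)"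
    proof
      assume "k * l = 1 \<and> k * (1 / l) = 1"
      then have "k = l" "k * l = 1" using pos by (auto simp: field_simps)
      then have "l = 1 \<or> l = - 1" by (simp add: square_eq_1_iff)
      then show False using pos ne1 by linarith
    qed
    ultimately consider "mink \<xi> p = 0" | "mink \<xi> q = 0"
      by (metis mult_cancel_right1)
    then show "\<xi> \<in> {(1 / p$0) *\<^sub>R p, (1 / q$0) *\<^sub>R q}"
    proof cases
      case 1
      then show ?thesis using null_orth(2)[OF pp p_ne _ null] ideal_unique[OF k(1)] by blast
    next
      case 2
      then show ?thesis using null_orth(2)[OF qq q_ne _ null] ideal_unique[OF k(1)] by blast
    qed
  qed
qed

lemma ideal_points_distinct: "(1 / p$0) *\<^sub>R p \<noteq> (1 / q$0) *\<^sub>R q"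
proof
  assume eq: "(1 / p$0) *\<^sub>R p = (1 / q$0) *\<^sub>R q"
  have "p$0 \<noteq> 0" "q$0 \<noteq> 0" using null_time_nonzero pp qq p_ne q_ne by blast+
  moreover have "mink ((1 / p$0) *\<^sub>R p) q = 0" unfolding eq by (simp add: mink_simps qq)
  ultimately show False using pq by (simp add: mink_simps)
qed

lemma hyperbolic_class: "orient_pres B \<Longrightarrow> hyperbolic_cl B"
  unfolding hyperbolic_cl_def using fixpts_empty ideal_fix_eq ideal_points_distinct by blast

lemma span_timelike: obtains z where "z \<in> span {p, q}" "mink z z < 0"
proof
  define z where "z = p - (1 / mink p q) *\<^sub>R q"
  show "z \<in> span {p, q}" unfolding z_def by (intro span_diff span_scale span_base) auto
  have "mink z z = -2" using pq by (simp add: z_def mink_simps pp qq mink_sym[of q p])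
  then show "mink z z < 0" by simp
qed

lemma dim_span: "dim (span {p, q}) = 2"
proof -
  have "p \<notin> span {q}"
    by (rule notin_span_perp[of q]) (simp_all add: perp_def qq pq)
  moreover have "q \<notin> span {}" using q_ne by simp
  ultimately show ?thesis by (simp only: dim_span dim_insert) simp
qed

lemma span_Int_ideal: "span {p, q} \<inter> ideal = ideal_fix B"
proof
  show "ideal_fix B \<subseteq> span {p, q} \<inter> ideal"
    unfolding ideal_fix_eq using ideal_normalize[OF pp p_ne] ideal_normalize[OF qq q_ne]
    by (auto intro: span_scale span_base)
  show "span {p, q} \<inter> ideal \<subseteq> ideal_fix B"
  proof
    fix \<xi> assume \<xi>: "\<xi> \<in> span {p, q} \<inter> ideal"
    then obtain a where "\<xi> - a *\<^sub>R p \<in> span {q}" by (auto simp: span_insert)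
    then obtain b where "\<xi> - a *\<^sub>R p = b *\<^sub>R q" by (auto simp: span_singleton)
    then have eq: "\<xi> = a *\<^sub>R p + b *\<^sub>R q" by (simp add: algebra_simps)
    have "mink \<xi> \<xi> = 2 * a * b * mink p q"
      by (simp add: eq mink_simps pp qq mink_sym[of q p])
    moreover have "mink \<xi> \<xi> = 0" using \<xi> by (simp add: ideal_def)
    ultimately have "a = 0 \<or> b = 0" using pq by simp
    then have "\<xi> = b *\<^sub>R q \<or> \<xi> = a *\<^sub>R p" using eq by auto
    then show "\<xi> \<in> ideal_fix B" unfolding ideal_fix_eq using ideal_unique \<xi> by blast
  qed
qed

lemma axis_span: "axis B (span {p, q} \<inter> hyp)"
proof -
  obtain z where "z \<in> span {p, q}" "mink z z < 0" by (rule span_timelike)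
  then show ?thesis unfolding axis_def
    using ideal_bd_subspace[OF subspace_span] span_Int_ideal
      gsubI[OF subspace_span, of _ 1 z] dim_span by simp
qed

lemma hyperplane_in_F_set:
  assumes "pure_hyp B" "n \<in> span {p, q}" "mink n n > 0"
  shows "ideal_bd (hyperplane_of n) \<in> F_set B"
proof -
  obtain z where "z \<in> span {p, q}" "mink z z < 0" by (rule span_timelike)
  then have "span (span {p, q} \<inter> hyp) = span {p, q}" by (rule span_subspace_hyp[OF subspace_span])
  then have "orth_to (hyperplane_of n) (span {p, q} \<inter> hyp)"
    unfolding orth_to_def using assms by blast
  then show ?thesis unfolding F_set_def using assms axis_span is_hyperplane_of by blast
qed

lemma hyperplane_in_T_set:
  assumes "pure_hyp B" "mink n p = 0" "mink n q = 0" "mink n n > 0"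
  shows "ideal_bd (hyperplane_of n) \<in> T_set B"
proof -
  have "n \<in> perp (span {p, q})" unfolding perp_span using assms by (simp add: perp_def)
  then have "span {p, q} \<inter> hyp \<subseteq> hyperplane_of n"
    by (auto simp: perp_def hyperplane_of_def mink_sym)
  then show ?thesis unfolding T_set_def using assms axis_span is_hyperplane_of by blast
qed

end

text \<open>The assumption \<open>fix_orth\<close> excludes fixed points in \<open>hyp\<close>,
  since those are never orthogonal to \<open>n\<close>, and it also excludes a second ideal fixed
  point: one not orthogonal to \<open>n\<close> would have eigenvalue 1. The locale covers pure and
  screw parabolics alike.\<close>

locale parabolic_eig =
  fixes B :: "real^5^5" and n :: "real^5"
  assumes isom: "isom B" and nn: "mink n n = 0" and n_ne: "n \<noteq> 0" and Bn: "B *v n = n"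
    and fix_orth: "\<And>x. B *v x = x \<Longrightarrow> mink x n = 0"
begin

lemma parabolic_class:
  assumes "orient_pres B"
  shows "parabolic B"
proof -
  have "fixpts B = {}"
    using fix_orth hyp_not_orth_null[OF _ nn n_ne] by (auto simp: fixpts_def)
  moreover have "ideal_fix B = {(1 / n$0) *\<^sub>R n}"
  proof
    show "{(1 / n$0) *\<^sub>R n} \<subseteq> ideal_fix B"
      using ideal_normalize[OF nn n_ne] Bn unfolding ideal_fix_def
      by (auto simp: matrix_vector_mult_scaleR intro!: exI[of _ 1])
    show "ideal_fix B \<subseteq> {(1 / n$0) *\<^sub>R n}"
    proof
      fix \<xi> assume "\<xi> \<in> ideal_fix B"
      then obtain k where k: "\<xi> \<in> ideal" "B *v \<xi> = k *\<^sub>R \<xi>" by (auto simp: ideal_fix_def)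
      then have null: "mink \<xi> \<xi> = 0" by (simp add: ideal_def)
      have "mink \<xi> n = k * mink \<xi> n"
        using isomD[OF isom, of \<xi> n] k Bn by (simp add: mink_simps)
      then have "mink \<xi> n = 0" using fix_orth[of \<xi>] k by auto
      then show "\<xi> \<in> {(1 / n$0) *\<^sub>R n}"
        using null_orth(2)[OF nn n_ne _ null] ideal_unique[OF k(1)] by blast
    qed
  qed
  ultimately show ?thesis using assms by (auto simp: parabolic_def)
qed

end

section \<open>Products of reflections in two unit normals: rotation, hyperbolic and parabolic
  cases\<close>

locale unit_pair =
  fixes u v :: "real^5"
  assumes uu: "mink u u = 1" and vv: "mink v v = 1"
begin

abbreviation "A \<equiv> refl u ** refl v"

lemma orient: "orient_pres A"
  by (rule orient_pres_refl_refl[OF uu vv])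

lemma isom_A: "isom A"
  using orient by (simp add: orient_pres_def)

lemma fixed_orth:
  assumes "A *v x = x" "(mink u v)\<^sup>2 \<noteq> 1"
  shows "mink x u = 0" "mink x v = 0"
proof -
  \<comment> \<open>A fixed vector has the same image under both reflections, so its components
    along \<open>u\<close> and \<open>v\<close> agree; pairing with \<open>u\<close> and with
    \<open>v\<close> gives a linear system of determinant \<open>1 - (mink u v)^2\<close>.\<close>
  have "refl u *v (refl u *v (refl v *v x)) = refl u *v x"
    using assms(1) by (simp flip: matrix_vector_mul_assoc)
  then have "refl v *v x = refl u *v x" by (simp add: refl_involutive uu)
  then have eq: "(2 * mink x v) *\<^sub>R v = (2 * mink x u) *\<^sub>R u" by (simp add: refl_unit uu vv)
  have 1: "mink x v * mink u v = mink x u"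
    using arg_cong[OF eq, of "mink u"] by (simp add: mink_simps uu)
  have 2: "mink x v = mink x u * mink u v"
    using arg_cong[OF eq, of "mink v"] by (simp add: mink_simps vv mink_sym[of v u])
  have "mink x u * (1 - (mink u v)\<^sup>2) = 0"
    using 1 2 by (simp add: power2_eq_square algebra_simps)
  then show "mink x u = 0" using assms(2) by simp
  then show "mink x v = 0" using 2 by simp
qed

end

locale rotation_pair = unit_pair +
  assumes c: "(mink u v)\<^sup>2 < 1"
begin

lemma fixpts_eq: "fixpts A = perp {u, v} \<inter> hyp"
  using fixed_orth c refl_refl_fixed by (auto simp: fixpts_def perp_def)

lemma residual_pos: "mink (v - mink u v *\<^sub>R u) (v - mink u v *\<^sub>R u) > 0"
proof -
  have "mink (v - mink u v *\<^sub>R u) (v - mink u v *\<^sub>R u) = 1 - (mink u v)\<^sup>2"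
    by (simp add: mink_simps uu vv mink_sym[of v u] power2_eq_square)
  then show ?thesis using c by simp
qed

lemma residual_orth: "mink u (v - mink u v *\<^sub>R u) = 0"
  by (simp add: mink_simps uu)

lemma perp_timelike: obtains z where "z \<in> perp {u, v}" "mink z z < 0"
proof -
  obtain z where "mink z z < 0" "mink z u = 0" "mink z (v - mink u v *\<^sub>R u) = 0"
    using timelike_perp2[OF _ residual_pos residual_orth] uu by auto
  then show ?thesis using that[of z] by (simp add: perp_def mink_simps)
qed

lemma v_notin: "v \<notin> span {u}"
  by (rule notin_span_perp[of "v - mink u v *\<^sub>R u"])
     (use c in \<open>auto simp: perp_def mink_simps uu vv mink_sym[of v u] power2_eq_square\<close>)

lemma type1: "type1 A"
proof -
  obtain z where z: "z \<in> perp {u, v}" "mink z z < 0" by (rule perp_timelike)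
  have "u \<notin> span {}" using uu by (auto simp: mink_simps)
  then have "dim {v, u} = 2" using v_notin by (simp only: dim_insert) simp
  then have "dim (perp {u, v}) = 3" using dim_perp[of "{u, v}"] by (simp add: insert_commute)
  then show ?thesis unfolding type1_def
    using orient gsubI[OF subspace_perp _ z fixpts_eq] by simp
qed

lemma span_fixpts: "span (fixpts A) = perp {u, v}"
  unfolding fixpts_eq by (rule perp_timelike) (rule span_subspace_hyp[OF subspace_perp])

lemma hyperplane_in_R_set:
  assumes "a = u \<or> a = v"
  shows "ideal_bd (hyperplane_of a) \<in> R_set A"
proof -
  have "fixpts A \<subseteq> hyperplane_of a"
    using assms unfolding fixpts_eq by (auto simp: perp_def hyperplane_of_def)
  moreover have "is_hyperplane (hyperplane_of a)"
    using assms uu vv by (intro is_hyperplane_of) auto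
  ultimately show ?thesis unfolding R_set_def by blast
qed

lemma hyperplane_in_F_set:
  assumes "a = u \<or> a = v"
  shows "ideal_bd (hyperplane_of a) \<in> F_set A"
  using hyperplane_in_R_set[OF assms] type1 unfolding R_set_def F_set_def by blast

lemma hyperplane_in_T_set:
  assumes "mink w u = 0" "mink w v = 0" "mink w w > 0"
  shows "ideal_bd (hyperplane_of w) \<in> T_set A"
proof -
  have "orth_to (hyperplane_of w) (fixpts A)"
    unfolding orth_to_def span_fixpts using assms by (auto simp: perp_def)
  then show ?thesis unfolding T_set_def using type1 is_hyperplane_of[OF assms(3)] by blast
qed

end

locale hyperbolic_pair = unit_pair +
  assumes c: "mink u v > 1"
begin

text \<open>If \<open>mink u v\<close> is written as cosh d, this is exp d: the larger root of
  \<open>t^2 - 2 (mink u v) t + 1\<close>, which is the norm of \<open>u - t v\<close>. The other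
  root is \<open>1 / lam\<close>, so \<open>p\<close> and \<open>q\<close> below are null
  vectors.\<close>

definition lam :: real where "lam = mink u v + sqrt ((mink u v)\<^sup>2 - 1)"
definition p :: "real^5" where "p = u - lam *\<^sub>R v"
definition q :: "real^5" where "q = u - (1 / lam) *\<^sub>R v"

lemma lam_gt: "lam > 1"
proof -
  have "(mink u v)\<^sup>2 > 1" using c by (simp add: power2_eq_square less_1_mult)
  then have "sqrt ((mink u v)\<^sup>2 - 1) > 0" by simp
  then show ?thesis using c unfolding lam_def by linarith
qed

lemma lam_quadratic: "lam * lam = 2 * mink u v * lam - 1"
proof -
  have "(mink u v)\<^sup>2 - 1 \<ge> 0" using c by (simp add: power2_eq_square less_1_mult less_imp_le)
  then have "(lam - mink u v)\<^sup>2 = (mink u v)\<^sup>2 - 1" by (simp add: lam_def)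
  then show ?thesis by (simp add: power2_eq_square algebra_simps)
qed

lemma inner_eq: "mink u v = (lam + 1 / lam) / 2"
  using lam_quadratic lam_gt by (simp add: field_simps)

text \<open>Stated for any isometry \<open>B\<close> agreeing with \<open>A\<close> on
  \<open>p\<close> and \<open>q\<close>, so that it also applies when a rotation fixing
  \<open>p\<close> and \<open>q\<close> is composed with \<open>A\<close>.\<close>

lemma eig:
  assumes "isom B" "B *v p = A *v p" "B *v q = A *v q"
  shows "hyperbolic_eig B p q (1 / (lam * lam))"
proof
  have lam: "lam > 1" "lam \<noteq> 0" using lam_gt by auto
  have ll: "lam * lam > 1" using lam by (simp add: less_1_mult)
  have vu: "mink v u = (lam + 1 / lam) / 2" using inner_eq by (simp add: mink_sym)
  show "isom B" by (rule assms)
  show "1 / (lam * lam) > 0" using lam by simp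
  show "1 / (lam * lam) \<noteq> 1" using ll by simp
  show "mink p p = 0" "mink q q = 0"
    using lam by (simp_all add: p_def q_def mink_simps uu vv vu inner_eq field_simps)
  have "mink p q = 1 - (lam * lam + 1 / (lam * lam)) / 2"
    using lam by (simp add: p_def q_def mink_simps uu vv vu inner_eq field_simps)
  also have "\<dots> = - ((lam * lam - 1)\<^sup>2 / (2 * (lam * lam)))"
    using lam by (simp add: field_simps power2_eq_square)
  also have "\<dots> < 0" using ll lam by simp
  finally show "mink p q \<noteq> 0" by simp
  have up: "mink p u = (1 - lam * lam) / 2" "mink p v = (1 / lam - lam) / 2"
    "mink q u = (1 - 1 / (lam * lam)) / 2" "mink q v = (lam - 1 / lam) / 2"
    using lam by (simp_all add: p_def q_def mink_simps uu vv vu inner_eq field_simps)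
  have "A *v p = (1 / (lam * lam)) *\<^sub>R p"
    unfolding refl_refl_apply[OF uu vv] up vu unfolding p_def
    using lam by (simp add: vec_eq_iff field_simps)
  then show "B *v p = (1 / (lam * lam)) *\<^sub>R p" using assms by simp
  have "A *v q = (lam * lam) *\<^sub>R q"
    unfolding refl_refl_apply[OF uu vv] up vu unfolding q_def
    using lam by (simp add: vec_eq_iff field_simps)
  then show "B *v q = (1 / (1 / (lam * lam))) *\<^sub>R q" using assms by simp
qed

sublocale E: hyperbolic_eig A p q "1 / (lam * lam)"
  by (rule eig[OF isom_A refl refl])

lemma uv_span: "v \<in> span {p, q}" "u \<in> span {p, q}"
proof -
  have "lam * lam > 1" using lam_gt by (simp add: less_1_mult)
  then have ne: "1 / lam - lam \<noteq> 0" using lam_gt by (simp add: field_simps)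
  have "p - q = (1 / lam - lam) *\<^sub>R v"
    by (simp add: p_def q_def scaleR_diff_left)
  then have "v = (1 / (1 / lam - lam)) *\<^sub>R (p - q)"
    using ne by simp
  also have "\<dots> \<in> span {p, q}" by (intro span_scale span_diff span_base) auto
  finally show v: "v \<in> span {p, q}" .
  have "u = p + lam *\<^sub>R v" by (simp add: p_def)
  also have "\<dots> \<in> span {p, q}" by (intro span_add span_scale v span_base) simp
  finally show "u \<in> span {p, q}" .
qed

lemma orth_pq_iff: "mink x p = 0 \<and> mink x q = 0 \<longleftrightarrow> mink x u = 0 \<and> mink x v = 0"
proof
  assume "mink x p = 0 \<and> mink x q = 0"
  then have "x \<in> perp (span {p, q})" unfolding perp_span by (simp add: perp_def)
  then show "mink x u = 0 \<and> mink x v = 0" using uv_span by (simp add: perp_def)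
qed (simp add: p_def q_def mink_simps)

lemma pure_hyp: "pure_hyp A"
  by (rule pure_hypI[OF orient E.pos E.ne1 E.pp E.qq E.pq E.Bp E.Bq])
     (use orth_pq_iff refl_refl_fixed in blast)

text \<open>The span of \<open>u, v\<close> contains a timelike vector. This is what later prevents
  a second non-elliptic factor.\<close>

lemma orth_pos:
  assumes "mink x u = 0" "mink x v = 0" "x \<noteq> 0"
  shows "mink x x > 0"
proof -
  obtain z where z: "z \<in> span {p, q}" "mink z z < 0" by (rule E.span_timelike)
  have "x \<in> perp (span {p, q})" unfolding perp_span using assms orth_pq_iff by (simp add: perp_def)
  then show ?thesis using timelike_orth[OF z(2) _ assms(3)] z(1) by (simp add: perp_def)
qed

lemma hyperplane_in_F_set:
  assumes "a = u \<or> a = v"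
  shows "ideal_bd (hyperplane_of a) \<in> F_set A"
  using assms uv_span by (intro E.hyperplane_in_F_set pure_hyp) (auto simp: uu vv)

lemma hyperplane_in_T_set:
  assumes "mink w u = 0" "mink w v = 0" "mink w w > 0"
  shows "ideal_bd (hyperplane_of w) \<in> T_set A"
  using assms orth_pq_iff by (intro E.hyperplane_in_T_set pure_hyp) auto

end

section \<open>Vectors orthogonal to the direction of infinity, and the parabolic case\<close>

lemma horizontal_hpart: "horizontal (hpart x)"
  by (simp add: horizontal_def hpart_def)

lemma mink_horizontal: "horizontal w \<Longrightarrow> mink x w = x \<bullet> w"
  by (simp add: mink_inner horizontal_def)

lemma orth_e01_decomp:
  assumes "mink x e01 = 0"
  shows "x = hpart x + x$0 *\<^sub>R e01"
proof -
  have "x$1 = x$0" using assms by (simp add: mink_e01)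
  then show ?thesis by (simp add: vec_eq_iff hpart_def e01_def)
qed

text \<open>On the complement of \<open>e01\<close> the form ignores multiples of
  \<open>e01\<close>, so it descends to the Euclidean product of horizontal parts.\<close>

lemma mink_hpart:
  assumes "mink x e01 = 0" "mink y e01 = 0"
  shows "mink (hpart x) (hpart y) = mink x y"
proof -
  have "mink e01 e01 = 0" "mink e01 y = 0" using assms by (simp_all add: mink_e01 mink_sym[of e01 y])
  moreover have "hpart x = x - x$0 *\<^sub>R e01" "hpart y = y - y$0 *\<^sub>R e01"
    using orth_e01_decomp assms by (metis add_diff_cancel_right')+
  ultimately show ?thesis using assms by (simp add: mink_simps)
qed

lemma image_hyperplane_of:
  assumes "isom g" "\<And>x. g *v (g *v x) = x"
  shows "(\<lambda>x. g *v x) ` hyperplane_of (g *v n) = hyperplane_of n"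
proof -
  have "g *v x \<in> hyperplane_of n" if "x \<in> hyperplane_of (g *v n)" for x
    using that isomD[OF assms(1), of "g *v x" n] assms(2)[of x] isom_hyp[OF assms(1)]
    by (simp add: hyperplane_of_def)
  moreover have "g *v x \<in> hyperplane_of (g *v n)" if "x \<in> hyperplane_of n" for x
    using that isomD[OF assms(1), of x n] isom_hyp[OF assms(1)]
    by (simp add: hyperplane_of_def)
  ultimately show ?thesis using assms(2) by (force intro: rev_image_eqI)
qed

lemma hyperplane_of_scale: "k \<noteq> 0 \<Longrightarrow> hyperplane_of (k *\<^sub>R n) = hyperplane_of n"
  by (simp add: hyperplane_of_def mink_simps)

locale parabolic_pair = unit_pair +
  assumes c: "mink u v = 1" and ne: "u \<noteq> v"
begin

definition n :: "real^5" where "n = u - v"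

lemma n_null: "mink n n = 0"
  using c by (simp add: n_def mink_simps uu vv mink_sym[of v u])

lemma n_ne: "n \<noteq> 0"
  using ne by (simp add: n_def)

lemma n_orth: "mink n u = 0" "mink n v = 0"
  using c by (simp_all add: n_def mink_simps uu vv mink_sym[of v u])

lemma A_n: "A *v n = n"
  by (rule refl_refl_fixed) (use n_orth in auto)

text \<open>The swap \<open>g\<close> moves the common ideal point of the two hyperplanes to
  infinity, where they become parallel Euclidean planes with unit normal \<open>w\<close> at heights
  \<open>a\<close> and \<open>b\<close>. Reflecting in the second and then in the first translates
  by twice the displacement, \<open>2 (a - b) w\<close>.\<close>

lemma horospherical_chart:
  "\<exists>g w a b. isom g \<and> (\<forall>x. g *v (g *v x) = x) \<and>
    g *v u = w + a *\<^sub>R e01 \<and> g *v v = w + b *\<^sub>R e01 \<and> a \<noteq> b \<and>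
    horizontal w \<and> par_conj A g ((2 * (a - b)) *\<^sub>R w) \<and>
    (\<forall>x. mink x n = 0 \<longrightarrow> mink (g *v x) e01 = 0)"
proof -
  have n0: "n$0 \<noteq> 0" by (rule null_time_nonzero[OF n_null n_ne])
  define n' where "n' = (1 / n$0) *\<^sub>R n"
  have id: "n' \<in> ideal" "e01 \<in> ideal"
    using ideal_normalize[OF n_null n_ne] by (auto simp: n'_def ideal_def mink_e01)
  then have e: "mink e01 e01 = 0" "mink n' n' = 0" "mink e01 n' < 0 \<or> e01 = n'"
    using mink_ideal[of e01 n'] by (auto simp: ideal_def)
  obtain g where g: "isom g" "g *v e01 = n'" "\<And>x. g *v (g *v x) = x"
    using isom_null_swap[OF e] by blast
  have gn: "g *v n = n$0 *\<^sub>R e01"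
  proof -
    have "g *v n' = e01" using g(3)[of e01] g(2) by simp
    moreover have "n = n$0 *\<^sub>R n'" using n0 by (simp add: n'_def)
    ultimately show ?thesis by (metis matrix_vector_mult_scaleR)
  qed
  have orth: "mink (g *v x) e01 = 0" if "mink x n = 0" for x
    using isomD[OF g(1), of x n] that gn n0 by (simp add: mink_simps)
  define U where "U = g *v u"
  define V where "V = g *v v"
  define w where "w = hpart U"
  define a where "a = U$0"
  define b where "b = a - n$0"
  have Ue: "mink U e01 = 0" using orth n_orth by (simp add: U_def mink_sym[of u n])
  then have U: "U = w + a *\<^sub>R e01" by (simp add: w_def a_def orth_e01_decomp[symmetric])
  have V: "V = w + b *\<^sub>R e01"
  proof -
    have "U - V = n$0 *\<^sub>R e01" using gn by (simp add: U_def V_def n_def matrix_vector_mult_diff_distrib)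
    then have "V = U - n$0 *\<^sub>R e01" by (simp add: algebra_simps)
    then show ?thesis using U by (simp add: b_def scaleR_diff_left)
  qed
  have hw: "horizontal w" by (simp add: w_def horizontal_hpart)
  have ww: "mink w w = 1"
    using mink_hpart[OF Ue Ue] isomD[OF g(1), of u u] uu by (simp add: w_def U_def)
  have ab: "a \<noteq> b" using n0 by (simp add: b_def)
  let ?b = "(2 * (a - b)) *\<^sub>R w"
  have "A *v (g *v x) = g *v ptransl ?b x" for x
  proof -
    have gU: "mink (g *v x) u = mink x U" "mink (g *v x) v = mink x V" "g *v U = u" "g *v V = v"
      using isomD[OF g(1), of "g *v x" u] isomD[OF g(1), of "g *v x" v] g(3)
      by (simp_all add: U_def V_def)
    have "A *v (g *v x) = g *v (x - (2 * mink x V) *\<^sub>R V - (2 * (mink x U - 2 * mink x V)) *\<^sub>R U)"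
      using c unfolding refl_refl_apply[OF uu vv]
      by (simp add: gU mink_sym[of v u] matrix_vector_mult_diff_distrib matrix_vector_mult_scaleR)
    also have "x - (2 * mink x V) *\<^sub>R V - (2 * (mink x U - 2 * mink x V)) *\<^sub>R U = ptransl ?b x"
    proof -
      have ip: "x \<bullet> w = mink x w" "w \<bullet> w = 1" using hw ww by (simp_all add: mink_horizontal)
      have E: "x$0 - x$1 = - mink x e01" by (simp add: mink_e01)
      show ?thesis
        unfolding ptransl_def E U V
        by (simp add: mink_simps ip vec_eq_iff)
           (simp add: add_divide_distrib diff_divide_distrib algebra_simps)
    qed
    finally show ?thesis .
  qed
  moreover have "horizontal ?b" "?b \<noteq> 0"
    using hw ww ab by (auto simp: horizontal_def mink_simps)
  ultimately have "par_conj A g ?b" using g(1) unfolding par_conj_def by blast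
  then show ?thesis using g(1,3) U V hw ab orth unfolding U_def V_def by blast
qed

lemma pure_par: "pure_par A"
  unfolding pure_par_def using orient horospherical_chart by blast

lemma hyperplane_in_F_set:
  assumes "x = u \<or> x = v"
  shows "ideal_bd (hyperplane_of x) \<in> F_set A"
proof -
  obtain g w a b where g: "isom g" "\<And>x. g *v (g *v x) = x"
    "g *v u = w + a *\<^sub>R e01" "g *v v = w + b *\<^sub>R e01" "a \<noteq> b"
    "par_conj A g ((2 * (a - b)) *\<^sub>R w)"
    using horospherical_chart by blast
  define k where "k = 2 * (a - b)"
  have k: "k \<noteq> 0" using g by (simp add: k_def)
  obtain d where d: "g *v x = w + d *\<^sub>R e01" using assms g(3,4) by blast
  \<comment> \<open>\<open>F_set\<close> takes the translation vector itself as normal, so the unit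
    normal is rescaled by \<open>k\<close>.\<close>
  have "k *\<^sub>R w + (k * d) *\<^sub>R e01 = k *\<^sub>R (g *v x)"
    by (simp add: d scaleR_add_right)
  then have "hyperplane_of x = (\<lambda>y. g *v y) ` hyperplane_of (k *\<^sub>R w + (k * d) *\<^sub>R e01)"
    using image_hyperplane_of[OF g(1,2), of x] hyperplane_of_scale[OF k] by simp
  moreover have "par_conj A g (k *\<^sub>R w)" using g(6) by (simp add: k_def)
  ultimately have "ideal_bd (hyperplane_of x) =
      ideal_bd ((\<lambda>y. g *v y) ` hyperplane_of (k *\<^sub>R w + (k * d) *\<^sub>R e01)) \<and>
      pure_par A \<and> par_conj A g (k *\<^sub>R w)"
    using pure_par by simp
  then show ?thesis unfolding F_set_def by blast
qed

lemma hyperplane_in_T_set: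
  assumes "mink x u = 0" "mink x v = 0" "mink x x > 0"
  shows "ideal_bd (hyperplane_of x) \<in> T_set A"
proof -
  obtain g w a b where g: "isom g" "\<And>x. g *v (g *v x) = x"
    "g *v u = w + a *\<^sub>R e01" "horizontal w" "par_conj A g ((2 * (a - b)) *\<^sub>R w)"
    "\<And>x. mink x n = 0 \<Longrightarrow> mink (g *v x) e01 = 0"
    using horospherical_chart by blast
  define h where "h = hpart (g *v x)"
  have xe: "mink (g *v x) e01 = 0" using g(6) assms by (simp add: n_def mink_simps)
  then have gx: "g *v x = h + (g *v x)$0 *\<^sub>R e01" unfolding h_def by (rule orth_e01_decomp)
  have hh: "horizontal h" by (simp add: h_def horizontal_hpart)
  have "mink h h = mink x x"
    using mink_hpart[OF xe xe] isomD[OF g(1)] by (simp add: h_def)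
  then have h0: "h \<noteq> 0" using assms(3) by (auto simp: mink_simps)
  have "mink (g *v x) (g *v u) = mink h w"
    using g(4) hh
    by (subst gx, subst g(3)) (simp add: mink_simps mink_sym[of e01] mink_e01 horizontal_def)
  then have "h \<bullet> w = 0"
    using isomD[OF g(1)] assms mink_horizontal[OF g(4)] by simp
  then have hb: "h \<bullet> ((2 * (a - b)) *\<^sub>R w) = 0" by simp
  have "hyperplane_of x = (\<lambda>y. g *v y) ` hyperplane_of (h + (g *v x)$0 *\<^sub>R e01)"
    using image_hyperplane_of[OF g(1,2), of x] gx by simp
  then have "ideal_bd (hyperplane_of x) =
      ideal_bd ((\<lambda>y. g *v y) ` hyperplane_of (h + (g *v x)$0 *\<^sub>R e01)) \<and>
      pure_par A \<and> par_conj A g ((2 * (a - b)) *\<^sub>R w) \<and> horizontal h \<and> h \<noteq> 0 \<and>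
      h \<bullet> ((2 * (a - b)) *\<^sub>R w) = 0"
    using pure_par g(5) hh h0 hb by simp
  then show ?thesis unfolding T_set_def by blast
qed

lemma eig:
  assumes "isom B" "B *v n = A *v n" "\<And>x. B *v x = x \<Longrightarrow> mink x n = 0"
  shows "parabolic_eig B n"
  using assms A_n n_null n_ne by unfold_locales auto

end

section \<open>Pairs of normal planes\<close>

text \<open>One half of the obstruction to being pure: the dilation fixes the whole horizontal
  space, of which two vectors suffice.\<close>

lemma pure_hyp_fixed:
  assumes "pure_hyp B"
  obtains x y where "B *v x = x" "B *v y = y" "x \<noteq> 0" "y \<notin> span {x}"
proof -
  obtain g l where g: "isom g" "\<And>x. B *v (g *v x) = g *v dil l x"
    using assms unfolding pure_hyp_def by blast
  define e2 :: "real^5" where "e2 = Finite_Cartesian_Product.axis 2 1"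
  define e3 :: "real^5" where "e3 = Finite_Cartesian_Product.axis 3 1"
  have d: "dil l e2 = e2" "dil l e3 = e3"
    by (simp_all add: vec_eq_iff dil_def e2_def e3_def Finite_Cartesian_Product.axis_def)
  have "e2 \<noteq> 0" by (simp add: e2_def axis_eq_0_iff)
  then have x: "g *v e2 \<noteq> 0" using isom_inj[OF g(1), of e2 0] by auto
  have "g *v e3 \<notin> span {g *v e2}"
  proof
    assume "g *v e3 \<in> span {g *v e2}"
    then obtain k where "g *v e3 = g *v (k *\<^sub>R e2)"
      by (auto simp: span_singleton matrix_vector_mult_scaleR)
    then have "e3 = k *\<^sub>R e2" by (rule isom_inj[OF g(1)])
    then have "e3$3 = (k *\<^sub>R e2)$3" by simp
    then show False by (simp add: e2_def e3_def Finite_Cartesian_Product.axis_def)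
  qed
  then show ?thesis using that[of "g *v e2" "g *v e3"] g(2) d x by simp
qed

lemma pure_par_fixed:
  assumes "pure_par B"
  obtains x y where "B *v x = x" "B *v y = y" "x \<noteq> 0" "y \<notin> span {x}"
proof -
  obtain g b where g: "isom g" "horizontal b" "b \<noteq> 0" "\<And>x. B *v (g *v x) = g *v ptransl b x"
    using assms unfolding pure_par_def par_conj_def by blast
  define e2 :: "real^5" where "e2 = Finite_Cartesian_Product.axis 2 1"
  define e3 :: "real^5" where "e3 = Finite_Cartesian_Product.axis 3 1"
  \<comment> \<open>A second fixed vector besides \<open>e01\<close> is any horizontal vector
    orthogonal to \<open>b\<close>: either the second coordinate vector already is, or the
    projection of \<open>b\<close> to coordinates 2 and 3 is turned by a right angle.\<close>
  obtain w where w: "horizontal w" "w \<noteq> 0" "w \<bullet> b = 0"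
  proof (cases "b$2 = 0")
    case True
    have "horizontal e2" by (simp add: e2_def horizontal_def Finite_Cartesian_Product.axis_def)
    moreover have "e2 \<noteq> 0" "e2 \<bullet> b = 0" using True by (simp_all add: e2_def axis_eq_0_iff inner_axis')
    ultimately show ?thesis by (rule that)
  next
    case False
    define w where "w = b$3 *\<^sub>R e2 - b$2 *\<^sub>R e3"
    have "w$3 \<noteq> 0" using False by (simp add: w_def e2_def e3_def Finite_Cartesian_Product.axis_def)
    then have "w \<noteq> 0" by auto
    moreover have "horizontal w"
      by (simp add: w_def e2_def e3_def horizontal_def Finite_Cartesian_Product.axis_def)
    moreover have "w \<bullet> b = 0"
      by (simp add: w_def e2_def e3_def inner_diff_left inner_axis')
    ultimately show ?thesis using that by blast
  qed
  have "e01 \<bullet> b = 0" using g(2) by (simp add: e01_axis inner_add_left inner_axis' horizontal_def)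
  then have pe: "ptransl b e01 = e01" by (simp add: ptransl_def)
  have pw: "ptransl b w = w" using w by (simp add: ptransl_def horizontal_def)
  have "e01 \<noteq> 0" using e01_nth(1) by (metis zero_index zero_neq_one)
  then have x: "g *v e01 \<noteq> 0" using isom_inj[OF g(1), of e01 0] by auto
  have "g *v w \<notin> span {g *v e01}"
  proof
    assume "g *v w \<in> span {g *v e01}"
    then obtain k where "g *v w = g *v (k *\<^sub>R e01)"
      by (auto simp: span_singleton matrix_vector_mult_scaleR)
    then have wk: "w = k *\<^sub>R e01" by (rule isom_inj[OF g(1)])
    then have "k = 0" using w(1) by (simp add: horizontal_def)
    then show False using wk w(2) by simp
  qed
  then show ?thesis using that[of "g *v e01" "g *v w"] g(4) pe pw x by simp
qed

lemma refl_commute: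
  assumes "mink a b = 0"
  shows "refl a ** refl b = refl b ** refl a"
  using assms by (simp add: matrix_eq refl_apply mink_simps mink_sym[of b a] flip: matrix_vector_mul_assoc)

lemma bank_pureI:
  assumes "type1 A \<or> pure_hyp A \<or> pure_par A" "s \<in> F_set A" "t \<in> T_set A"
  shows "s \<inter> t \<in> bank A"
proof -
  have "s \<inter> t \<in> {s \<inter> t | s t. (type1 A \<or> pure_hyp A \<or> pure_par A) \<and> s \<in> F_set A \<and> t \<in> T_set A}"
    using assms by (intro CollectI exI[of _ s] exI[of _ t]) simp
  then show ?thesis unfolding bank_def by (intro UnI1)
qed

lemma bank_screwI:
  assumes "pure_lox (\<tau> ** \<rho>) \<or> screw_par (\<tau> ** \<rho>)" "\<tau> ** \<rho> = \<rho> ** \<tau>" "pure_hyp \<tau> \<or> pure_par \<tau>"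
    "type1 \<rho>" "s \<in> F_set \<tau>" "t \<in> R_set \<rho>"
  shows "s \<inter> t \<in> bank (\<tau> ** \<rho>)"
proof -
  have "s \<inter> t \<in> {s \<inter> t | s t. (pure_lox (\<tau> ** \<rho>) \<or> screw_par (\<tau> ** \<rho>)) \<and>
        (\<exists>\<tau>' \<rho>'. \<tau> ** \<rho> = \<tau>' ** \<rho>' \<and> \<tau>' ** \<rho>' = \<rho>' ** \<tau>' \<and> (pure_hyp \<tau>' \<or> pure_par \<tau>') \<and> type1 \<rho>' \<and>
                s \<in> F_set \<tau>' \<and> t \<in> R_set \<rho>')}"
    using assms by (intro CollectI exI[of _ s] exI[of _ t] conjI exI[of _ \<tau>] exI[of _ \<rho>]) simp_all
  then show ?thesis unfolding bank_def by (intro UnI1 UnI2)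
qed

lemma bank_type2I:
  assumes "type2 (\<rho>1 ** \<rho>2)" "(\<rho>1 ** \<rho>2) ** (\<rho>1 ** \<rho>2) \<noteq> mat 1" "fixpts (\<rho>1 ** \<rho>2) = {x}"
    "\<rho>1 ** \<rho>2 = \<rho>2 ** \<rho>1" "type1 \<rho>1" "type1 \<rho>2" "meet_orth (fixpts \<rho>1) (fixpts \<rho>2) x"
    "s \<in> F_set \<rho>1" "t \<in> F_set \<rho>2"
  shows "s \<inter> t \<in> bank (\<rho>1 ** \<rho>2)"
proof -
  have "s \<inter> t \<in> {s \<inter> t | s t. type2 (\<rho>1 ** \<rho>2) \<and> (\<rho>1 ** \<rho>2) ** (\<rho>1 ** \<rho>2) \<noteq> mat 1 \<and>
        (\<exists>\<rho>1' \<rho>2' x. fixpts (\<rho>1 ** \<rho>2) = {x} \<and> \<rho>1 ** \<rho>2 = \<rho>1' ** \<rho>2' \<and> \<rho>1' ** \<rho>2' = \<rho>2' ** \<rho>1' \<and>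
                type1 \<rho>1' \<and> type1 \<rho>2' \<and> meet_orth (fixpts \<rho>1') (fixpts \<rho>2') x \<and>
                s \<in> F_set \<rho>1' \<and> t \<in> F_set \<rho>2')}"
    using assms
    by (intro CollectI exI[of _ s] exI[of _ t] conjI exI[of _ \<rho>1] exI[of _ \<rho>2] exI[of _ x]) simp_all
  then show ?thesis unfolding bank_def by (intro UnI1 UnI2)
qed

lemma bank_involutionI:
  "type2 A \<Longrightarrow> A ** A = mat 1 \<Longrightarrow> is_plane P \<Longrightarrow> fixpts A \<subseteq> P \<Longrightarrow> ideal_bd P \<in> bank A"
  unfolding bank_def by blast

lemma bank_identityI: "is_plane P \<Longrightarrow> ideal_bd P \<in> bank (mat 1)"
  unfolding bank_def by blast

text \<open>The diagonalised situation: \<open>u1, u2\<close> are orthonormal normals of one plane,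
  \<open>v1, v2\<close> of the other, and their pairing matrix is diagonal.\<close>

locale frame =
  fixes u1 v1 u2 v2 :: "real^5"
  assumes units: "mink u1 u1 = 1" "mink v1 v1 = 1" "mink u2 u2 = 1" "mink v2 v2 = 1"
    and orth: "mink u1 u2 = 0" "mink v1 v2 = 0" "mink u1 v2 = 0" "mink u2 v1 = 0"
begin

abbreviation "A1 \<equiv> refl u1 ** refl v1"
abbreviation "A2 \<equiv> refl u2 ** refl v2"

lemma orth': "mink u2 u1 = 0" "mink v2 v1 = 0" "mink v2 u1 = 0" "mink v1 u2 = 0"
  using orth by (simp_all add: mink_sym)

lemma swap: "frame u2 v2 u1 v1"
  using units orth orth' by unfold_locales auto

lemma commute: "A1 ** A2 = A2 ** A1"
proof -
  have "A1 ** A2 = refl u1 ** (refl v1 ** refl u2) ** refl v2" by (simp add: matrix_mul_assoc)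
  also have "\<dots> = refl u1 ** (refl u2 ** refl v1) ** refl v2" using refl_commute orth' by metis
  also have "\<dots> = (refl u1 ** refl u2) ** (refl v1 ** refl v2)" by (simp add: matrix_mul_assoc)
  also have "\<dots> = (refl u2 ** refl u1) ** (refl v2 ** refl v1)" using refl_commute orth by metis
  also have "\<dots> = refl u2 ** (refl u1 ** refl v2) ** refl v1" by (simp add: matrix_mul_assoc)
  also have "\<dots> = refl u2 ** (refl v2 ** refl u1) ** refl v1" using refl_commute orth by metis
  also have "\<dots> = A2 ** A1" by (simp add: matrix_mul_assoc)
  finally show ?thesis .
qed

text \<open>The left side is the splitting into commuting factors, the right side the product of the
  two half-turns; they differ by exchanging the commuting reflections in \<open>v1\<close> and
  \<open>u2\<close>.\<close>

lemma regroup: "A1 ** A2 = (refl u1 ** refl u2) ** (refl v1 ** refl v2)"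
proof -
  have "A1 ** A2 = refl u1 ** (refl v1 ** refl u2) ** refl v2" by (simp add: matrix_mul_assoc)
  also have "\<dots> = refl u1 ** (refl u2 ** refl v1) ** refl v2" using refl_commute orth' by metis
  finally show ?thesis by (simp add: matrix_mul_assoc)
qed

lemma orient: "orient_pres (A1 ** A2)"
  using units by (intro orient_pres_mult orient_pres_refl_refl)

lemma isom_gamma: "isom (A1 ** A2)"
  using orient by (simp add: orient_pres_def)

text \<open>On a fixed vector the two half-turns agree, so its projections to the two normal planes
  coincide; the scalar equations are the pairings of this identity with the frame vectors.\<close>

lemma fixed_eqs:
  assumes "(A1 ** A2) *v x = x"
  shows "mink x v1 *\<^sub>R v1 + mink x v2 *\<^sub>R v2 = mink x u1 *\<^sub>R u1 + mink x u2 *\<^sub>R u2"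
    "mink x v1 * mink u1 v1 = mink x u1" "mink x v1 = mink x u1 * mink u1 v1"
    "mink x v2 * mink u2 v2 = mink x u2" "mink x v2 = mink x u2 * mink u2 v2"
proof -
  have "refl u1 *v (refl u2 *v (refl v1 *v (refl v2 *v x))) = x"
    using assms unfolding regroup by (simp flip: matrix_vector_mul_assoc)
  then have "refl v1 *v (refl v2 *v x) = refl u2 *v (refl u1 *v x)"
    using units by (metis refl_involutive zero_neq_one)
  then have "(2 * mink x v1) *\<^sub>R v1 + (2 * mink x v2) *\<^sub>R v2
      = (2 * mink x u1) *\<^sub>R u1 + (2 * mink x u2) *\<^sub>R u2"
    using units orth orth' by (simp add: refl_unit mink_simps algebra_simps)
  then have "2 *\<^sub>R (mink x v1 *\<^sub>R v1 + mink x v2 *\<^sub>R v2)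
      = 2 *\<^sub>R (mink x u1 *\<^sub>R u1 + mink x u2 *\<^sub>R u2)"
    by (simp add: scaleR_add_right)
  then show eq: "mink x v1 *\<^sub>R v1 + mink x v2 *\<^sub>R v2 = mink x u1 *\<^sub>R u1 + mink x u2 *\<^sub>R u2"
    by (simp only: scaleR_cancel_left) simp
  show "mink x v1 * mink u1 v1 = mink x u1" "mink x v1 = mink x u1 * mink u1 v1"
    "mink x v2 * mink u2 v2 = mink x u2" "mink x v2 = mink x u2 * mink u2 v2"
    using arg_cong[OF eq, of "mink u1"] arg_cong[OF eq, of "mink v1"]
      arg_cong[OF eq, of "mink u2"] arg_cong[OF eq, of "mink v2"]
    by (simp_all add: mink_simps units orth orth' mink_sym[of v1 u1] mink_sym[of v2 u2])
qed

lemma fixed_orth2: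
  assumes "(A1 ** A2) *v x = x" "(mink u2 v2)\<^sup>2 \<noteq> 1"
  shows "mink x u2 = 0" "mink x v2 = 0"
proof -
  have "mink x u2 * (1 - (mink u2 v2)\<^sup>2) = 0"
    using fixed_eqs(4,5)[OF assms(1)] by (simp add: power2_eq_square algebra_simps)
  then show "mink x u2 = 0" using assms(2) by simp
  then show "mink x v2 = 0" using fixed_eqs(5)[OF assms(1)] by simp
qed

lemma fixed_orth1:
  assumes "(A1 ** A2) *v x = x" "(mink u1 v1)\<^sup>2 \<noteq> 1"
  shows "mink x u1 = 0" "mink x v1 = 0"
  using frame.fixed_orth2[OF swap _ assms(2), of x] assms(1) commute by simp_all

text \<open>With pairing 1 the scalar equations only say that \<open>x\<close> pairs equally with
  \<open>u1\<close> and \<open>v1\<close>. The vector identity supplies the rest, because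
  \<open>u1\<close> and \<open>v1\<close> differ.\<close>

lemma fixed_orth1_parabolic:
  assumes "(A1 ** A2) *v x = x" "mink u1 v1 = 1" "u1 \<noteq> v1" "(mink u2 v2)\<^sup>2 \<noteq> 1"
  shows "mink x u1 = 0" "mink x v1 = 0"
proof -
  have eq: "mink x v1 = mink x u1" using fixed_eqs(3)[OF assms(1)] assms(2) by simp
  then have "mink x u1 *\<^sub>R (v1 - u1) = 0"
    using fixed_eqs(1)[OF assms(1)] fixed_orth2[OF assms(1,4)] by (simp add: scaleR_diff_right)
  then show "mink x u1 = 0" using assms(3) by simp
  then show "mink x v1 = 0" using eq by simp
qed

lemma hyperplanes_Int:
  "ideal_bd (hyperplane_of u1 \<inter> hyperplane_of u2) = ideal_bd (hyperplane_of u1) \<inter> ideal_bd (hyperplane_of u2)"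
  "ideal_bd (hyperplane_of v1 \<inter> hyperplane_of v2) = ideal_bd (hyperplane_of v1) \<inter> ideal_bd (hyperplane_of v2)"
  using units orth by (simp_all add: ideal_bd_Int_hyperplanes)

text \<open>Named inside the locale so that the goal can be moved between frames of the same two
  planes: interchanged, with signs changed, or rotated.\<close>

definition circles_in_bank :: bool where
  "circles_in_bank \<longleftrightarrow> ideal_bd (hyperplane_of u1 \<inter> hyperplane_of u2) \<in> bank (A1 ** A2) \<and>
    ideal_bd (hyperplane_of v1 \<inter> hyperplane_of v2) \<in> bank (A1 ** A2)"

lemma is_planes:
  "is_plane (hyperplane_of u1 \<inter> hyperplane_of u2)" "is_plane (hyperplane_of v1 \<inter> hyperplane_of v2)"
proof -
  have *: "is_plane (hyperplane_of a \<inter> hyperplane_of b)"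
    if "mink a a = 1" "mink b b = 1" "mink a b = 0" for a b
  proof -
    have ab: "mink a a > 0" "mink b b > 0" "mink a b = 0" using that by auto
    obtain z where z: "mink z z < 0" "mink z a = 0" "mink z b = 0"
      using timelike_perp2[OF ab] by blast
    have "b \<notin> span {a}" by (rule notin_span_perp[of b]) (use that in \<open>auto simp: perp_def mink_sym\<close>)
    moreover have "a \<notin> span {}" using that by (auto simp: mink_simps)
    ultimately have "dim {b, a} = 2" by (simp only: dim_insert) simp
    then have "dim (perp {b, a}) = 3" using dim_perp[of "{b, a}"] by simp
    then show ?thesis
      by (intro gsubI[OF subspace_perp[of "{b, a}"], of _ z])
         (use z in \<open>auto simp: perp_def hyperplane_of_def\<close>)
  qed
  show "is_plane (hyperplane_of u1 \<inter> hyperplane_of u2)" "is_plane (hyperplane_of v1 \<inter> hyperplane_of v2)"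
    using * units orth by blast+
qed

section \<open>Membership in the bank according to the types of the two factors\<close>

lemma circles_in_bank_identity:
  assumes "u1 = v1" "u2 = v2"
  shows circles_in_bank
proof -
  have "A1 ** A2 = mat 1" using assms units by (simp add: refl_square)
  then show ?thesis unfolding circles_in_bank_def using is_planes bank_identityI by simp
qed

lemma A2_id: "u2 = v2 \<Longrightarrow> A1 ** A2 = A1"
  using units by (simp add: refl_square)

lemma circles_in_bank_pureI:
  assumes "u2 = v2" "type1 A1 \<or> pure_hyp A1 \<or> pure_par A1"
    and "\<And>a. a = u1 \<or> a = v1 \<Longrightarrow> ideal_bd (hyperplane_of a) \<in> F_set A1"
    and "ideal_bd (hyperplane_of u2) \<in> T_set A1"
  shows circles_in_bank
  unfolding circles_in_bank_def A2_id[OF assms(1)] hyperplanes_Int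
  using assms by (auto intro!: bank_pureI)

lemma circles_in_bank_screwI:
  assumes "pure_lox (A1 ** A2) \<or> screw_par (A1 ** A2)" "pure_hyp A1 \<or> pure_par A1" "type1 A2"
    and "\<And>a. a = u1 \<or> a = v1 \<Longrightarrow> ideal_bd (hyperplane_of a) \<in> F_set A1"
    and "\<And>a. a = u2 \<or> a = v2 \<Longrightarrow> ideal_bd (hyperplane_of a) \<in> R_set A2"
  shows circles_in_bank
  unfolding circles_in_bank_def hyperplanes_Int
  using assms commute by (intro conjI bank_screwI) simp_all

lemma dim_perp_all:
  assumes "v1 \<notin> span {u1}" "(mink u2 v2)\<^sup>2 \<noteq> 1"
  shows "dim (perp {v2, u2, v1, u1}) = 1"
proof -
  have 1: "u1 \<notin> span {}" using units by (auto simp: mink_simps)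
  have 2: "u2 \<notin> span {v1, u1}"
    by (rule notin_span_perp[of u2]) (use units orth orth' in \<open>auto simp: perp_def\<close>)
  have 3: "v2 \<notin> span {u2, v1, u1}"
    by (rule notin_span_perp[of "v2 - mink u2 v2 *\<^sub>R u2"])
       (use units orth orth' assms(2) in \<open>auto simp: perp_def mink_simps mink_sym[of v2 u2] power2_eq_square\<close>)
  have "dim {v2, u2, v1, u1} = 4" using 1 assms(1) 2 3 by (simp only: dim_insert) simp
  then show ?thesis using dim_perp[of "{v2, u2, v1, u1}"] by simp
qed

text \<open>The other half of the obstruction: fixed vectors are orthogonal to all four independent
  frame vectors, hence lie on a line.\<close>

lemma two_fixed_contra:
  assumes "v1 \<notin> span {u1}" "(mink u2 v2)\<^sup>2 \<noteq> 1"
    and "\<And>x. (A1 ** A2) *v x = x \<Longrightarrow> mink x u1 = 0 \<and> mink x v1 = 0"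
    and xy: "(A1 ** A2) *v x = x" "(A1 ** A2) *v y = y" "x \<noteq> 0" "y \<notin> span {x}"
  shows False
proof -
  have "dim {y, x} = 2" using xy by (simp only: dim_insert) simp
  moreover have "{y, x} \<subseteq> perp {v2, u2, v1, u1}"
    using assms(3) fixed_orth2[OF _ assms(2)] xy by (auto simp: perp_def)
  then have "dim {y, x} \<le> dim (perp {v2, u2, v1, u1})" by (rule dim_subset)
  ultimately show False using dim_perp_all[OF assms(1,2)] by simp
qed

lemma circles_in_bank_rotation:
  assumes "(mink u1 v1)\<^sup>2 < 1" "u2 = v2"
  shows circles_in_bank
proof -
  interpret rotation_pair u1 v1 using units assms by unfold_locales
  show ?thesis
    using type1 hyperplane_in_F_set hyperplane_in_T_set[of u2] orth orth' units
    by (intro circles_in_bank_pureI assms(2)) auto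
qed

lemma circles_in_bank_hyperbolic:
  assumes "mink u1 v1 > 1" "u2 = v2"
  shows circles_in_bank
proof -
  interpret hyperbolic_pair u1 v1 using units assms by unfold_locales
  show ?thesis
    using pure_hyp hyperplane_in_F_set hyperplane_in_T_set[of u2] orth orth' units
    by (intro circles_in_bank_pureI assms(2)) auto
qed

lemma circles_in_bank_parabolic:
  assumes "mink u1 v1 = 1" "u1 \<noteq> v1" "u2 = v2"
  shows circles_in_bank
proof -
  interpret parabolic_pair u1 v1 using units assms by unfold_locales
  show ?thesis
    using pure_par hyperplane_in_F_set hyperplane_in_T_set[of u2] orth orth' units
    by (intro circles_in_bank_pureI assms(3)) auto
qed

lemma A2_fixes:
  assumes "mink x u2 = 0" "mink x v2 = 0"
  shows "(A1 ** A2) *v x = A1 *v x"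
proof -
  have "(A1 ** A2) *v x = A1 *v (A2 *v x)" by (simp only: matrix_vector_mul_assoc)
  then show ?thesis using refl_refl_fixed[OF assms] by simp
qed

lemma circles_in_bank_loxodromic:
  assumes "mink u1 v1 > 1" "(mink u2 v2)\<^sup>2 < 1"
  shows circles_in_bank
proof -
  interpret H: hyperbolic_pair u1 v1 using units assms by unfold_locales
  interpret R: rotation_pair u2 v2 using units assms by unfold_locales
  have c1: "(mink u1 v1)\<^sup>2 \<noteq> 1" using assms(1) by (simp add: power2_eq_1_iff)
  \<comment> \<open>The rotation \<open>A2\<close> fixes the null eigenvectors of \<open>A1\<close>,
    so the product inherits them with the same eigenvalues.\<close>
  have "mink H.p u2 = 0" "mink H.p v2 = 0" "mink H.q u2 = 0" "mink H.q v2 = 0"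
    using orth orth' by (simp_all add: H.p_def H.q_def mink_simps)
  then interpret E: hyperbolic_eig "A1 ** A2" H.p H.q "1 / (H.lam * H.lam)"
    using isom_gamma A2_fixes by (intro H.eig) auto
  have v1: "v1 \<notin> span {u1}"
    by (rule notin_span_perp[of "v1 - mink u1 v1 *\<^sub>R u1"])
       (use units c1 in \<open>auto simp: perp_def mink_simps mink_sym[of v1 u1] power2_eq_square\<close>)
  have "\<not> pure_hyp (A1 ** A2)"
  proof
    assume "pure_hyp (A1 ** A2)"
    then obtain x y where xy: "(A1 ** A2) *v x = x" "(A1 ** A2) *v y = y" "x \<noteq> 0" "y \<notin> span {x}"
      by (rule pure_hyp_fixed)
    show False
      by (rule two_fixed_contra[OF v1 _ _ xy]) (use fixed_orth1[OF _ c1] assms(2) in simp_all)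
  qed
  then have "pure_lox (A1 ** A2)"
    using E.hyperbolic_class[OF orient] by (simp add: pure_lox_def)
  then show ?thesis
    using H.pure_hyp R.type1 H.hyperplane_in_F_set R.hyperplane_in_R_set
    by (intro circles_in_bank_screwI) auto
qed

lemma circles_in_bank_screw:
  assumes "mink u1 v1 = 1" "u1 \<noteq> v1" "(mink u2 v2)\<^sup>2 < 1"
  shows circles_in_bank
proof -
  interpret N: parabolic_pair u1 v1 using units assms by unfold_locales
  interpret R: rotation_pair u2 v2 using units assms by unfold_locales
  have c2: "(mink u2 v2)\<^sup>2 \<noteq> 1" using assms(3) by simp
  have fo: "mink x u1 = 0" "mink x v1 = 0" if "(A1 ** A2) *v x = x" for x
    using fixed_orth1_parabolic[OF that assms(1,2) c2] by auto
  have "mink N.n u2 = 0" "mink N.n v2 = 0"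
    using orth orth' by (simp_all add: N.n_def mink_simps)
  moreover have "mink x N.n = 0" if "(A1 ** A2) *v x = x" for x
    using fo[OF that] by (simp add: N.n_def mink_simps)
  ultimately interpret E: parabolic_eig "A1 ** A2" N.n
    using isom_gamma A2_fixes by (intro N.eig) auto
  have v1: "v1 \<notin> span {u1}"
  proof
    assume "v1 \<in> span {u1}"
    then obtain k where k: "v1 = k *\<^sub>R u1" by (auto simp: span_singleton)
    then have "k = 1" using assms(1) units by (simp add: mink_simps)
    then show False using k assms(2) by simp
  qed
  have "\<not> pure_par (A1 ** A2)"
  proof
    assume "pure_par (A1 ** A2)"
    then obtain x y where xy: "(A1 ** A2) *v x = x" "(A1 ** A2) *v y = y" "x \<noteq> 0" "y \<notin> span {x}"
      by (rule pure_par_fixed)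
    show False by (rule two_fixed_contra[OF v1 c2 _ xy]) (use fo in simp)
  qed
  then have "screw_par (A1 ** A2)"
    using E.parabolic_class[OF orient] by (simp add: screw_par_def)
  then show ?thesis
    using N.pure_par R.type1 N.hyperplane_in_F_set R.hyperplane_in_R_set
    by (intro circles_in_bank_screwI) auto
qed

lemma circles_in_bank_type2:
  assumes "(mink u1 v1)\<^sup>2 < 1" "(mink u2 v2)\<^sup>2 < 1"
  shows circles_in_bank
proof -
  interpret R1: rotation_pair u1 v1 using units assms by unfold_locales
  interpret R2: rotation_pair u2 v2 using units assms by unfold_locales
  let ?W = "perp {v2, u2, v1, u1}"
  have ne: "(mink u1 v1)\<^sup>2 \<noteq> 1" "(mink u2 v2)\<^sup>2 \<noteq> 1" using assms by auto
  have fixed: "(A1 ** A2) *v x = x \<longleftrightarrow> x \<in> ?W" for x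
  proof
    assume "(A1 ** A2) *v x = x"
    then show "x \<in> ?W" using fixed_orth1[OF _ ne(1)] fixed_orth2[OF _ ne(2)] by (simp add: perp_def)
  next
    assume "x \<in> ?W"
    then show "(A1 ** A2) *v x = x" using A2_fixes refl_refl_fixed by (simp add: perp_def)
  qed
  \<comment> \<open>A timelike vector orthogonal to the whole frame arises by projecting
    \<open>z\<close> off \<open>u2\<close> and then off the component of \<open>v2\<close>
    orthogonal to \<open>u2\<close>; it yields the unique fixed point \<open>x\<close>.\<close>
  obtain z where z: "z \<in> perp {u1, v1}" "mink z z < 0" by (rule R1.perp_timelike)
  obtain z1 where z1: "mink z1 z1 < 0" "mink z1 u2 = 0"
      "\<And>s. mink z s = 0 \<Longrightarrow> mink u2 s = 0 \<Longrightarrow> mink z1 s = 0"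
    using timelike_project[OF z(2), of u2] units by auto
  obtain z2 where z2: "mink z2 z2 < 0" "mink z2 (v2 - mink u2 v2 *\<^sub>R u2) = 0"
      "\<And>s. mink z1 s = 0 \<Longrightarrow> mink (v2 - mink u2 v2 *\<^sub>R u2) s = 0 \<Longrightarrow> mink z2 s = 0"
    using timelike_project[OF z1(1) R2.residual_pos] by auto
  have z1W: "mink z1 u1 = 0" "mink z1 v1 = 0"
    using z z1(3)[of u1] z1(3)[of v1] orth orth' by (simp_all add: perp_def)
  have "mink z2 u2 = 0" "mink z2 u1 = 0" "mink z2 v1 = 0"
    using z2(3)[of u2] z2(3)[of u1] z2(3)[of v1] z1(2) z1W orth orth' units
    by (simp_all add: mink_simps mink_sym[of v2 u2])
  then have zW: "z2 \<in> ?W" using z2(2) by (simp add: perp_def mink_simps)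
  obtain x where x: "x \<in> ?W" "x \<in> hyp" using subspace_meets_hyp[OF subspace_perp zW z2(1)] by blast
  have xx: "mink x x = -1" "x$0 > 0" "x \<noteq> 0" using x by (auto simp: hyp_def mink_simps)
  have line: "\<exists>k. y = k *\<^sub>R x" if "y \<in> ?W" for y
  proof (rule ccontr)
    assume "\<nexists>k. y = k *\<^sub>R x"
    then have "y \<notin> span {x}" by (auto simp: span_singleton)
    then show False
      by (intro two_fixed_contra[OF R1.v_notin ne(2) _ _ _ xx(3)])
         (use fixed_orth1[OF _ ne(1)] fixed x(1) that in simp_all)
  qed
  have fx: "fixpts (A1 ** A2) = {x}"
  proof
    show "{x} \<subseteq> fixpts (A1 ** A2)" using x fixed by (auto simp: fixpts_def)
    show "fixpts (A1 ** A2) \<subseteq> {x}"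
    proof
      fix y assume y: "y \<in> fixpts (A1 ** A2)"
      then obtain k where k: "y = k *\<^sub>R x" using line fixed by (auto simp: fixpts_def)
      have "mink y y = -1" "y$0 > 0" using y by (auto simp: fixpts_def hyp_def)
      then have "k * k = 1" "k > 0" using k xx by (auto simp: mink_simps zero_less_mult_iff)
      then have "k = 1" by (simp add: square_eq_1_iff)
      then show "y \<in> {x}" using k by simp
    qed
  qed
  then have t2: "type2 (A1 ** A2)" using orient by (auto simp: type2_def)
  show ?thesis
  proof (cases "(A1 ** A2) ** (A1 ** A2) = mat 1")
    case True
    have "fixpts (A1 ** A2) \<subseteq> hyperplane_of u1 \<inter> hyperplane_of u2"
      "fixpts (A1 ** A2) \<subseteq> hyperplane_of v1 \<inter> hyperplane_of v2"
      unfolding fx using x by (auto simp: hyperplane_of_def perp_def)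
    then show ?thesis
      unfolding circles_in_bank_def using t2 True is_planes by (intro conjI bank_involutionI) simp_all
  next
    case False
    have "meet_orth (fixpts A1) (fixpts A2) x"
      unfolding meet_orth_def R1.span_fixpts R2.span_fixpts
    proof (intro conjI ballI impI)
      show "fixpts A1 \<inter> fixpts A2 = {x}"
        using fx fixed unfolding R1.fixpts_eq R2.fixpts_eq by (auto simp: fixpts_def perp_def)
      fix a b assume a: "a \<in> perp {u1, v1}" and b: "b \<in> perp {u2, v2}" and ax: "mink a x = 0"
      define r where "r = v2 - mink u2 v2 *\<^sub>R u2"
      \<comment> \<open>\<open>a'\<close> is the part of \<open>a\<close> orthogonal to
        \<open>u2\<close> and \<open>v2\<close>. It lies on the line of \<open>x\<close> and is
        orthogonal to \<open>x\<close>, hence vanishes; so \<open>a\<close> lies in the span of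
        \<open>u2\<close> and \<open>v2\<close>, to which \<open>b\<close> is orthogonal.\<close>
      define a' where "a' = a - mink a u2 *\<^sub>R u2 - (mink a r / mink r r) *\<^sub>R r"
      have r: "mink r r > 0" "mink r u2 = 0" "mink r u1 = 0" "mink r v1 = 0" "mink u2 r = 0"
        "mink x r = 0"  "mink x u2 = 0"
        using R2.residual_pos R2.residual_orth orth orth' units x(1)
        by (simp_all add: r_def mink_simps mink_sym[of v2 u2] perp_def)
      have ar: "mink a' u2 = 0" "mink a' r = 0" "mink a' u1 = 0" "mink a' v1 = 0"
        using a r orth orth' units by (simp_all add: a'_def mink_simps perp_def)
      have "v2 = r + mink u2 v2 *\<^sub>R u2" by (simp add: r_def)
      then have "mink a' v2 = 0" using ar by (metis add.right_neutral mink_simps(2,6) mult_zero_right)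
      then have "a' \<in> ?W" using ar by (simp add: perp_def)
      then obtain k where k: "a' = k *\<^sub>R x" using line by blast
      have "mink a' x = 0" using ax r by (simp add: a'_def mink_simps mink_sym[of _ x])
      then have "a' = 0" using k xx by (simp add: mink_simps)
      then have aeq: "a = mink a u2 *\<^sub>R u2 + (mink a r / mink r r) *\<^sub>R r" by (simp add: a'_def algebra_simps)
      have "mink u2 b = 0" "mink r b = 0"
        using b by (simp_all add: r_def mink_simps perp_def mink_sym[of _ b])
      then show "mink a b = 0" by (subst aeq) (simp add: mink_simps)
    qed
    then show ?thesis
      unfolding circles_in_bank_def hyperplanes_Int
      using t2 False fx commute R1.type1 R2.type1 R1.hyperplane_in_F_set R2.hyperplane_in_F_set
      by (intro conjI bank_type2I) simp_all
  qed
qed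

end

section \<open>The general factorization\<close>

text \<open>The complement of a hyperbolic or parabolic first pair contains no timelike vector,
  which bounds the second pairing by 1. The alternative \<open>u1 = v1\<close> is left over for the
  interchanged frame.\<close>

lemma (in frame) circles_in_bank_first_nonelliptic:
  assumes "mink u1 v1 \<ge> 1" "mink u2 v2 \<ge> 0" "mink u1 v1 = 1 \<and> mink u2 v2 = 1 \<longrightarrow> u1 = v1 \<or> u2 = v2"
  shows "circles_in_bank \<or> u1 = v1"
proof -
  have small: "(mink u2 v2)\<^sup>2 < 1" if "mink u2 v2 < 1"
    using that assms(2) by (simp add: power_strict_mono[of _ 1 2, simplified] abs_square_less_1)
  \<comment> \<open>The component of \<open>u2\<close> orthogonal to \<open>v2\<close> is orthogonal
    to the first pair, and its norm measures how far the second pairing is from 1.\<close>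
  define y where "y = u2 - mink u2 v2 *\<^sub>R v2"
  have y: "mink y y = 1 - (mink u2 v2)\<^sup>2" "mink y u1 = 0" "mink y v1 = 0"
    using units orth orth' by (simp_all add: y_def mink_simps mink_sym[of v2 u2] power2_eq_square)
  consider "u1 = v1" | "mink u1 v1 > 1" | "mink u1 v1 = 1" "u1 \<noteq> v1" using assms(1) by linarith
  then show ?thesis
  proof cases
    case 2
    interpret hyperbolic_pair u1 v1 using units 2 by unfold_locales
    show ?thesis
    proof (cases "mink u2 v2 < 1")
      case True
      then show ?thesis using circles_in_bank_loxodromic 2 small by blast
    next
      case False
      then have "mink y y \<le> 0" using y(1) by simp
      then have "y = 0" using orth_pos[OF y(2,3)] by force
      then have uv: "u2 = mink u2 v2 *\<^sub>R v2" by (simp add: y_def)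
      have "(mink u2 v2)\<^sup>2 = 1" using y(1) \<open>y = 0\<close> by (simp add: mink_simps)
      then have "mink u2 v2 = 1" using assms(2) by (simp add: power2_eq_1_iff)
      then show ?thesis using uv circles_in_bank_hyperbolic 2 by simp
    qed
  next
    case 3
    interpret parabolic_pair u1 v1 using units 3 by unfold_locales
    have "mink y y \<ge> 0" using null_orth(1)[OF n_null n_ne, of y] y by (simp add: n_def mink_simps)
    then have "mink u2 v2 \<le> 1" using y(1) by (simp add: abs_square_le_1)
    then consider "mink u2 v2 < 1" | "u2 = v2" using assms(3) 3 by force
    then show ?thesis using circles_in_bank_screw[OF 3] circles_in_bank_parabolic[OF 3] small by cases blast+
  qed simp
qed

lemma (in frame) circles_in_bank_swap: "frame.circles_in_bank u2 v2 u1 v1 = circles_in_bank"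
  unfolding frame.circles_in_bank_def[OF swap] circles_in_bank_def commute by (simp add: Int_commute)

lemma (in frame) circles_in_bank_if_not_both_parabolic:
  assumes "mink u1 v1 \<ge> 0" "mink u2 v2 \<ge> 0"
    "mink u1 v1 = 1 \<and> mink u2 v2 = 1 \<longrightarrow> u1 = v1 \<or> u2 = v2"
  shows circles_in_bank
proof -
  interpret S: frame u2 v2 u1 v1 by (rule swap)
  have small: "x\<^sup>2 < 1" if "0 \<le> x" "x < 1" for x :: real
    using that by (simp add: abs_square_less_1)
  have one: "circles_in_bank \<or> u1 = v1" if "mink u1 v1 \<ge> 1"
    using circles_in_bank_first_nonelliptic that assms by blast
  have two: "circles_in_bank \<or> u2 = v2" if "mink u2 v2 \<ge> 1"
    using S.circles_in_bank_first_nonelliptic that assms circles_in_bank_swap by blast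
  consider "circles_in_bank" | "u1 = v1" "u2 = v2" | "u1 = v1" "mink u2 v2 < 1"
    | "mink u1 v1 < 1" "u2 = v2" | "mink u1 v1 < 1" "mink u2 v2 < 1"
    using one two by force
  then show ?thesis
  proof cases
    case 3
    then show ?thesis using S.circles_in_bank_rotation small assms circles_in_bank_swap by blast
  next
    case 4
    then show ?thesis using circles_in_bank_rotation small assms by blast
  next
    case 5
    then show ?thesis using circles_in_bank_type2 small assms by blast
  qed (use circles_in_bank_identity in blast)+
qed

text \<open>A rotation of the orthonormal normals, with \<open>a\<close>, \<open>b\<close> as cosine
  and sine, changes neither the plane nor its half-turn; this is the freedom used to
  diagonalise.\<close>

locale rotated_pair =
  fixes u w :: "real^5" and a b :: real
  assumes units: "mink u u = 1" "mink w w = 1" and orth: "mink u w = 0" and circle: "a\<^sup>2 + b\<^sup>2 = 1"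
begin

definition u' :: "real^5" where "u' = a *\<^sub>R u + b *\<^sub>R w"
definition w' :: "real^5" where "w' = a *\<^sub>R w - b *\<^sub>R u"

lemma wu: "mink w u = 0" using orth by (simp add: mink_sym)

lemma units': "mink u' u' = 1" "mink w' w' = 1" and orth': "mink u' w' = 0"
  using circle by (simp_all add: u'_def w'_def mink_simps units orth wu power2_eq_square algebra_simps)

lemma unrotate: "u = a *\<^sub>R u' - b *\<^sub>R w'" "w = b *\<^sub>R u' + a *\<^sub>R w'"
proof -
  have "a *\<^sub>R u' - b *\<^sub>R w' = (a\<^sup>2 + b\<^sup>2) *\<^sub>R u" "b *\<^sub>R u' + a *\<^sub>R w' = (a\<^sup>2 + b\<^sup>2) *\<^sub>R w"
    by (simp_all add: u'_def w'_def vec_eq_iff power2_eq_square algebra_simps)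
  then show "u = a *\<^sub>R u' - b *\<^sub>R w'" "w = b *\<^sub>R u' + a *\<^sub>R w'" using circle by simp_all
qed

lemma hyperplanes: "hyperplane_of u' \<inter> hyperplane_of w' = hyperplane_of u \<inter> hyperplane_of w"
proof -
  have "mink x u' = 0 \<and> mink x w' = 0 \<longleftrightarrow> mink x u = 0 \<and> mink x w = 0" for x
  proof
    assume "mink x u' = 0 \<and> mink x w' = 0"
    then show "mink x u = 0 \<and> mink x w = 0" by (subst unrotate(1), subst unrotate(2)) (simp add: mink_simps)
  qed (simp add: u'_def w'_def mink_simps)
  then show ?thesis by (auto simp: hyperplane_of_def)
qed

lemma half_turn_eq: "refl u' ** refl w' = refl u ** refl w"
proof -
  have "(refl u' ** refl w') *v x = (refl u ** refl w) *v x" for x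
  proof -
    define X Y where "X = mink x u'" and "Y = mink x w'"
    have e: "mink x u = a * X - b * Y" "mink x w = b * X + a * Y"
      unfolding X_def Y_def by (subst unrotate, simp add: mink_simps)+
    have "(2 * mink x w) *\<^sub>R w + (2 * mink x u) *\<^sub>R u
        = (2 * X) *\<^sub>R (a *\<^sub>R u + b *\<^sub>R w) + (2 * Y) *\<^sub>R (a *\<^sub>R w - b *\<^sub>R u)"
      unfolding e by (simp add: vec_eq_iff algebra_simps)
    then have "(2 * mink x w) *\<^sub>R w + (2 * mink x u) *\<^sub>R u = (2 * Y) *\<^sub>R w' + (2 * X) *\<^sub>R u'"
      by (simp add: u'_def w'_def)
    moreover have "mink w' u' = 0" using orth' by (simp add: mink_sym)
    ultimately show ?thesis
      unfolding refl_refl_apply[OF units'] refl_refl_apply[OF units] wu X_def Y_def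
      by (simp only: diff_diff_eq mult_zero_right diff_zero)
  qed
  then show ?thesis by (simp add: matrix_eq)
qed

end

text \<open>Singular value decomposition of the matrix with rows \<open>(m11, m12)\<close> and \<open>(m21, m22)\<close>:
  the off-diagonal conditions for rotations by \<open>\<theta>\<close> and \<open>\<phi>\<close> decouple in
  \<open>\<theta> + \<phi>\<close> and \<open>\<theta> - \<phi>\<close>.\<close>
lemma singular_rotations:
  fixes m11 m12 m21 m22 :: real
  obtains a b c d where "a\<^sup>2 + b\<^sup>2 = 1" "c\<^sup>2 + d\<^sup>2 = 1"
    "a * (c * m12 - d * m11) + b * (c * m22 - d * m21) = 0"
    "a * (c * m21 + d * m22) - b * (c * m11 + d * m12) = 0"
proof -
  obtain r \<alpha> where r: "m22 - m11 = r * cos \<alpha>" "m12 + m21 = r * sin \<alpha>"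
    using polar_Ex by blast
  obtain s \<beta> where s: "m11 + m22 = s * cos \<beta>" "m12 - m21 = s * sin \<beta>"
    using polar_Ex by blast
  \<comment> \<open>The sum and the difference of the angles become \<open>- \<alpha>\<close> and
    \<open>- \<beta>\<close>, so that both conditions reduce to the vanishing of sine at
    zero.\<close>
  define \<theta> where "\<theta> = (- \<alpha> - \<beta>) / 2"
  define \<phi> where "\<phi> = (\<beta> - \<alpha>) / 2"
  have add: "\<theta> + \<phi> = - \<alpha>" "\<theta> - \<phi> = - \<beta>" by (simp_all add: \<theta>_def \<phi>_def field_simps)
  define a b c d where "a = cos \<theta>" and "b = sin \<theta>" and "c = cos \<phi>" and "d = sin \<phi>"
  have "(m22 - m11) * sin (\<theta> + \<phi>) + (m12 + m21) * cos (\<theta> + \<phi>) = 0"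
    "(m11 + m22) * sin (\<theta> - \<phi>) + (m12 - m21) * cos (\<theta> - \<phi>) = 0"
    unfolding add r s by simp_all
  then have "(m22 - m11) * (b * c + a * d) + (m12 + m21) * (a * c - b * d) = 0"
    "(m11 + m22) * (b * c - a * d) + (m12 - m21) * (a * c + b * d) = 0"
    by (simp_all add: sin_add cos_add sin_diff cos_diff a_def b_def c_def d_def)
  then have "a * (c * m12 - d * m11) + b * (c * m22 - d * m21) = 0"
    "a * (c * m21 + d * m22) - b * (c * m11 + d * m12) = 0"
    by (simp_all add: algebra_simps)
  then show ?thesis using that[of a b c d] by (simp add: a_def b_def c_def d_def)
qed

lemma half_turn_unit_normals:
  assumes "half_turn P HP"
  obtains u w where "mink u u = 1" "mink w w = 1" "mink u w = 0"
    "P = hyperplane_of u \<inter> hyperplane_of w" "HP = refl u ** refl w"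
proof -
  obtain u w where uw: "mink u u > 0" "mink w w > 0" "mink u w = 0"
    "hyperplane_of u \<inter> hyperplane_of w = P" "HP = refl u ** refl w"
    using assms unfolding half_turn_def by blast
  define a b where "a = 1 / sqrt (mink u u)" and "b = 1 / sqrt (mink w w)"
  have ab: "a \<noteq> 0" "b \<noteq> 0" using uw by (simp_all add: a_def b_def)
  show ?thesis
    by (rule that[of "a *\<^sub>R u" "b *\<^sub>R w"])
       (use uw ab in \<open>simp_all add: mink_simps refl_scale hyperplane_of_scale\<close>,
        use uw in \<open>simp_all add: a_def b_def\<close>)
qed

lemma (in frame) circles_in_bank_nonneg:
  assumes "mink u1 v1 \<ge> 0" "mink u2 v2 \<ge> 0"
  shows circles_in_bank
proof (cases "mink u1 v1 = 1 \<and> mink u2 v2 = 1 \<and> u1 \<noteq> v1")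
  case False
  then show ?thesis using circles_in_bank_if_not_both_parabolic assms by blast
next
  case True
  text \<open>The null vectors \<open>u1 - v1\<close> and \<open>u2 - v2\<close> are proportional; rotating both normal planes
    by the same angle makes the second pair coincide.\<close>
  interpret parabolic_pair u1 v1 using units True by unfold_locales auto
  have "mink (u2 - v2) n = 0" "mink (u2 - v2) (u2 - v2) = 0"
    using units orth orth' True by (simp_all add: n_def mink_simps mink_sym[of v2 u2])
  then obtain k where k: "u2 - v2 = k *\<^sub>R n" using null_orth(2)[OF n_null n_ne] by blast
  \<comment> \<open>Cosine and sine of the angle with tangent \<open>k\<close>: then
    \<open>a (u2 - v2) = b (u1 - v1)\<close>, which says that the rotated second normals
    coincide.\<close>
  define a b where "a = 1 / sqrt (1 + k\<^sup>2)" and "b = k / sqrt (1 + k\<^sup>2)"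
  have pos: "1 + k\<^sup>2 > 0" by (simp add: add_pos_nonneg)
  have ab: "a\<^sup>2 + b\<^sup>2 = 1"
    using pos by (simp add: a_def b_def power_divide flip: add_divide_distrib)
  have bk: "b = k * a" by (simp add: a_def b_def)
  interpret RU: rotated_pair u1 u2 a b using units orth ab by unfold_locales
  interpret RV: rotated_pair v1 v2 a b using units orth ab by unfold_locales
  have "a *\<^sub>R (u2 - v2) - b *\<^sub>R (u1 - v1) = 0" using k by (simp add: n_def bk mult.commute)
  then have same: "RU.w' = RV.w'" by (simp add: RU.w'_def RV.w'_def algebra_simps)
  have c': "mink RU.u' RV.u' = 1" "mink RU.u' RV.w' = 0" "mink RU.w' RV.u' = 0"
    using ab True orth orth'
    by (simp_all add: RU.u'_def RV.u'_def RU.w'_def RV.w'_def mink_simps power2_eq_square algebra_simps)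
  interpret F: frame RU.u' RV.u' RU.w' RV.w'
    using RU.units' RV.units' RU.orth' RV.orth' c' by unfold_locales
  have "F.circles_in_bank"
    using F.circles_in_bank_if_not_both_parabolic same c' RU.units' by simp
  then show ?thesis
    unfolding F.circles_in_bank_def circles_in_bank_def RU.hyperplanes RV.hyperplanes
      F.regroup regroup RU.half_turn_eq RV.half_turn_eq .
qed

text \<open>Each \<open>vi\<close> is multiplied by the sign of its pairing with \<open>ui\<close>,
  with sign 1 at zero; reflections and hyperplanes do not notice.\<close>

lemma frame_circles_in_bank:
  assumes "frame u1 v1 u2 v2"
  shows "frame.circles_in_bank u1 v1 u2 v2"
proof -
  interpret frame u1 v1 u2 v2 by fact
  define s :: "real \<Rightarrow> real" where "s x = (if x < 0 then - 1 else 1)" for x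
  define w1 w2 where "w1 = s (mink u1 v1) *\<^sub>R v1" and "w2 = s (mink u2 v2) *\<^sub>R v2"
  have s: "s x \<noteq> 0" "s x * s x = 1" "s x * x \<ge> 0" for x by (simp_all add: s_def)
  interpret F: frame u1 w1 u2 w2
    using units orth by unfold_locales (simp_all add: w1_def w2_def mink_simps s)
  have "F.circles_in_bank"
    by (rule F.circles_in_bank_nonneg) (simp_all add: w1_def w2_def mink_simps s)
  then show ?thesis
    unfolding F.circles_in_bank_def circles_in_bank_def by (simp add: w1_def w2_def s refl_scale hyperplane_of_scale)
qed

theorem theorem6p10:
  fixes \<gamma> HP HQ :: "real^5^5" and P Q :: "(real^5) set"
  assumes "orient_pres \<gamma>"
    and "is_plane P" and "is_plane Q"
    and "half_turn P HP" and "half_turn Q HQ"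
    and "\<gamma> = HP ** HQ"
  shows "ideal_bd P \<in> bank \<gamma> \<and> ideal_bd Q \<in> bank \<gamma>"
proof -
  obtain u w where P: "mink u u = 1" "mink w w = 1" "mink u w = 0"
    "P = hyperplane_of u \<inter> hyperplane_of w" "HP = refl u ** refl w"
    using half_turn_unit_normals[OF assms(4)] .
  obtain x y where Q: "mink x x = 1" "mink y y = 1" "mink x y = 0"
    "Q = hyperplane_of x \<inter> hyperplane_of y" "HQ = refl x ** refl y"
    using half_turn_unit_normals[OF assms(5)] .
  obtain a b c d where r: "a\<^sup>2 + b\<^sup>2 = 1" "c\<^sup>2 + d\<^sup>2 = 1"
    "a * (c * mink u y - d * mink u x) + b * (c * mink w y - d * mink w x) = 0"
    "a * (c * mink w x + d * mink w y) - b * (c * mink u x + d * mink u y) = 0"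
    by (rule singular_rotations)
  interpret U: rotated_pair u w a b using P r by unfold_locales
  interpret V: rotated_pair x y c d using Q r by unfold_locales
  \<comment> \<open>The off-diagonal pairings of the rotated bases are the two expressions that the
    choice of angles annihilates.\<close>
  have "mink U.u' V.w' = 0" "mink U.w' V.u' = 0"
    using r(3,4) by (simp_all add: U.u'_def U.w'_def V.u'_def V.w'_def mink_simps algebra_simps)
  then interpret frame U.u' V.u' U.w' V.w'
    using U.units' V.units' U.orth' V.orth' by unfold_locales
  have circles_in_bank by (rule frame_circles_in_bank) unfold_locales
  then show ?thesis
    unfolding circles_in_bank_def regroup U.hyperplanes V.hyperplanes U.half_turn_eq V.half_turn_eq
      assms(6) P(4,5) Q(4,5) .
qed

end
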